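(* Let $B$ denote the duration of a busy period in the Erlang queue with multiple arrivals that is initiated by the arrival, into the empty system, of a group of customers bringing $a$ service phases, $a\in\{k,2k,\dots,lk\}$ (that is, a group of $a/k$ customers), and let $F_B(t)$ be its distribution function. Then, for $t\ge 0$, $$F_B(t)=a\sum_{n=0}^{\infty}\lambda^n\sum_{\substack{m_1+\dots+m_l=n\\ m_j\in\mathbb{N}_0}}\Big(\prod_{i=1}^{l}\frac{c_i^{m_i}}{m_i!}\Big)\frac{(k\mu)^{a+k\sum_{j=1}^{l}jm_j}}{\big(a+k\sum_{j=1}^{l}jm_j\big)!}\int_0^tz^{a+n+k\sum_{j=1}^{l}jm_j-1}e^{-(\lambda+k\mu)z}\,\mathrm dz.$$
   Context: Let $k,l\ge 1$ be integers, $\mu>0$, $\lambda_1,\dots,\lambda_l>0$, $\lambda=\lambda_1+\dots+\lambda_l$ and $c_m=\lambda_m/\lambda$ for $1\le m\le l$. $\mathbb{N}_0=\{0,1,2,\dots\}$. The Erlang queue with multiple arrivals is the continuous-time Markov process $\mathcal{Q}(t)=(\mathcal{N}(t),\mathcal{S}(t))$, $t\ge 0$, on the state space $\mathcal{H}_0=\mathcal{H}\cup\{(0,0)\}$, $\mathcal{H}=\{(n,s)\in\mathbb{N}\times\mathbb{N}: n\ge 1,\ 1\le s\le k\}$, with $\mathcal{Q}(0)=(0,0)$. Here $\mathcal{N}(t)$ is the number of customers in a single-channel system and $\mathcal{S}(t)$ is the phase of the customer in service (each service starts in phase $k$, and the phases are counted down to $1$), with $\mathcal{S}(t)=0$ if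 $\mathcal{N}(t)=0$. Its nonzero transition rates (an event of rate $q$ has probability $qh+o(h)$ in an interval of length $h$) are, for $1\le m\le l$: (arrivals) $(0,0)\to(m,k)$ at rate $\lambda_m=\lambda c_m$, and $(n,s)\to(n+m,s)$ at rate $\lambda_m=\lambda c_m$ for $(n,s)\in\mathcal{H}$; (service, each phase being exponential with mean $1/(k\mu)$) at rate $k\mu$: $(n,s)\to(n,s-1)$ for $n\ge1$, $2\le s\le k$; $(n,1)\to(n-1,k)$ for $n\ge 2$; and $(1,1)\to(0,0)$. The queue length process in terms of phases is $\mathcal{L}(t)=k(\mathcal{N}(t)-1)+\mathcal{S}(t)$ if $\mathcal{N}(t)>0$, and $\mathcal{L}(t)=0$ if $\mathcal{N}(t)=0$. A busy period is the time interval starting from the arrival of customer(s) into an initially empty system until the system (server and queue) becomes empty again. Let $\{\mathcal{L}_*(t)\}_{t\ge 0}$ be the process with $\mathcal{L}_*(0)=a$ that evolves with the same transition rates as $\mathcal{L}$ from positive states and is absorbed at $0$; then $F_B(t)=\Pr(\mathcal{L}_*(t)=0\mid\mathcal{L}_*(0)=a)$. *)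

theory Defs
  imports "HOL-Probability.Probability" "HOL-Library.Landau_Symbols"
begin

section \<open>Continuous-time Markov processes on a countable state space\<close>

definition transition_function :: "'s set \<Rightarrow> (real \<Rightarrow> 's \<Rightarrow> 's \<Rightarrow> real) \<Rightarrow> bool" where
  "transition_function S p \<longleftrightarrow>
     (\<forall>t\<ge>0. \<forall>x\<in>S. \<forall>y\<in>S. 0 \<le> p t x y) \<and>
     (\<forall>t\<ge>0. \<forall>x\<in>S. (p t x has_sum 1) S) \<and>
     (\<forall>x\<in>S. \<forall>y\<in>S. p 0 x y = (if x = y then 1 else 0)) \<and>
     (\<forall>s\<ge>0. \<forall>t\<ge>0. \<forall>x\<in>S. \<forall>z\<in>S. ((\<lambda>y. p s x y * p t y z) has_sum p (s + t) x z) S)"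

text \<open>
  An event of rate \<open>r\<close> has probability \<open>r * h + o(h)\<close> in an interval of length \<open>h\<close>, and no
  event occurs with probability one minus the total rate times \<open>h\<close>, up to \<open>o(h)\<close>. Only the
  values of \<open>q\<close> at pairs of distinct states matter.
\<close>
definition has_transition_rates ::
    "'s set \<Rightarrow> (real \<Rightarrow> 's \<Rightarrow> 's \<Rightarrow> real) \<Rightarrow> ('s \<Rightarrow> 's \<Rightarrow> real) \<Rightarrow> bool" where
  "has_transition_rates S p q \<longleftrightarrow>
     (\<forall>x\<in>S. \<forall>y\<in>S. x \<noteq> y \<longrightarrow> (\<lambda>h. p h x y - q x y * h) \<in> o[at_right 0](\<lambda>h. h)) \<and>
     (\<forall>x\<in>S. (\<lambda>h. p h x x - (1 - (\<Sum>\<^sub>\<infinity>y\<in>S - {x}. q x y) * h)) \<in> o[at_right 0](\<lambda>h. h))"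

text \<open>
  The Markov property is stated in product form, so that it also makes sense when the
  conditioning event has probability zero.
\<close>
definition markov_process ::
    "'w measure \<Rightarrow> (real \<Rightarrow> 'w \<Rightarrow> 's) \<Rightarrow> 's set \<Rightarrow> ('s \<Rightarrow> 's \<Rightarrow> real) \<Rightarrow> bool" where
  "markov_process M X S q \<longleftrightarrow>
     prob_space M \<and>
     (\<forall>t\<ge>0. X t \<in> measurable M (count_space S)) \<and>
     (\<exists>p. transition_function S p \<and> has_transition_rates S p q \<and>
        (\<forall>(n::nat) (\<tau>::nat \<Rightarrow> real) (x::nat \<Rightarrow> 's).
           0 \<le> \<tau> 0 \<longrightarrow> (\<forall>i\<le>n. \<tau> i < \<tau> (Suc i)) \<longrightarrow> (\<forall>i\<le>Suc n. x i \<in> S) \<longrightarrow>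
           \<P>(\<omega> in M. \<forall>i\<le>Suc n. X (\<tau> i) \<omega> = x i) =
           \<P>(\<omega> in M. \<forall>i\<le>n. X (\<tau> i) \<omega> = x i) * p (\<tau> (Suc n) - \<tau> n) (x n) (x (Suc n))))"

text \<open>Right continuity of the paths with respect to the discrete topology on the states.\<close>
definition right_continuous_paths :: "'w measure \<Rightarrow> (real \<Rightarrow> 'w \<Rightarrow> 's) \<Rightarrow> bool" where
  "right_continuous_paths M X \<longleftrightarrow>
     (\<forall>\<omega>\<in>space M. \<forall>t\<ge>0. \<forall>\<^sub>F s in at_right t. X s \<omega> = X t \<omega>)"

section \<open>The Erlang queue with multiple arrivals\<close>

definition erlang_states :: "nat \<Rightarrow> (nat \<times> nat) set" where
  "erlang_states k = insert (0, 0) {(n, s). 1 \<le> n \<and> 1 \<le> s \<and> s \<le> k}"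

definition erlang_rate ::
    "nat \<Rightarrow> nat \<Rightarrow> real \<Rightarrow> (nat \<Rightarrow> real) \<Rightarrow> nat \<times> nat \<Rightarrow> nat \<times> nat \<Rightarrow> real" where
  "erlang_rate k l \<mu> lam x y =
     (case x of (n, s) \<Rightarrow>
        (\<Sum>m=1..l. if (n = 0 \<and> y = (m, k)) \<or> (n \<ge> 1 \<and> y = (n + m, s)) then lam m else 0) +
        (if (n \<ge> 1 \<and> s \<ge> 2 \<and> y = (n, s - 1)) \<or>
            (n \<ge> 2 \<and> s = 1 \<and> y = (n - 1, k)) \<or>
            (n = 1 \<and> s = 1 \<and> y = (0, 0)) then real k * \<mu> else 0))"

definition erlang_queue ::
    "'w measure \<Rightarrow> (real \<Rightarrow> 'w \<Rightarrow> nat \<times> nat) \<Rightarrow> nat \<Rightarrow> nat \<Rightarrow> real \<Rightarrow> (nat \<Rightarrow> real) \<Rightarrow> bool" where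
  "erlang_queue M Q k l \<mu> lam \<longleftrightarrow>
     markov_process M Q (erlang_states k) (erlang_rate k l \<mu> lam) \<and>
     right_continuous_paths M Q \<and>
     (AE \<omega> in M. Q 0 \<omega> = (0, 0))"

subsection \<open>The first busy period\<close>

definition busy_start :: "(real \<Rightarrow> 'w \<Rightarrow> nat \<times> nat) \<Rightarrow> 'w \<Rightarrow> ereal" where
  "busy_start Q \<omega> = (INF t\<in>{t. 0 \<le> t \<and> fst (Q t \<omega>) > 0}. ereal t)"

text \<open>The number of customers in the group that starts the busy period, or 0 if nobody ever arrives.\<close>
definition initial_group :: "(real \<Rightarrow> 'w \<Rightarrow> nat \<times> nat) \<Rightarrow> 'w \<Rightarrow> nat" where
  "initial_group Q \<omega> =
     (if busy_start Q \<omega> = \<infinity> then 0 else fst (Q (real_of_ereal (busy_start Q \<omega>)) \<omega>))"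

text \<open>The duration is \<open>\<infinity>\<close> if the system never empties again.\<close>
definition busy_duration :: "(real \<Rightarrow> 'w \<Rightarrow> nat \<times> nat) \<Rightarrow> 'w \<Rightarrow> ereal" where
  "busy_duration Q \<omega> =
     (INF t\<in>{t. busy_start Q \<omega> \<le> ereal t \<and> fst (Q t \<omega>) = 0}. ereal t) - busy_start Q \<omega>"

subsection \<open>The queue length in phases\<close>

definition phases :: "nat \<Rightarrow> nat \<times> nat \<Rightarrow> nat" where
  "phases k = (\<lambda>(n, s). if n > 0 then k * (n - 1) + s else 0)"

lemma bij_betw_phases:
  assumes "k \<ge> 1"
  shows "bij_betw (phases k) (erlang_states k) UNIV"
proof (rule bij_betwI[where g = "\<lambda>i. if i = 0 then (0, 0) else ((i - 1) div k + 1, (i - 1) mod k + 1)"])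
  show "(\<lambda>i. if i = 0 then (0, 0) else ((i - 1) div k + 1, (i - 1) mod k + 1)) \<in> UNIV \<rightarrow> erlang_states k"
    using assms by (auto simp: erlang_states_def Suc_le_eq)
next
  fix x assume x: "x \<in> erlang_states k"
  obtain n s where xs: "x = (n, s)" by (cases x)
  show "(if phases k x = 0 then (0, 0)
      else ((phases k x - 1) div k + 1, (phases k x - 1) mod k + 1)) = x"
  proof (cases n)
    case 0
    then show ?thesis using x xs by (simp add: phases_def erlang_states_def)
  next
    case (Suc n')
    then obtain s' where "s = Suc s'" "s' < k"
      using x xs by (cases s) (auto simp: erlang_states_def)
    then show ?thesis using Suc xs by (simp add: phases_def)
  qed
next
  fix i :: nat
  show "phases k (if i = 0 then (0, 0) else ((i - 1) div k + 1, (i - 1) mod k + 1)) = i"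
    by (auto simp: phases_def)
qed auto

text \<open>
  Since \<^term>\<open>phases k\<close> is a bijection on the states, the queue length in phases is itself a Markov
  process, whose rates are those of the queue transported along this bijection. Here they are
  kept at positive states, and 0 is made absorbing.
\<close>
definition absorbed_phase_rate ::
    "nat \<Rightarrow> nat \<Rightarrow> real \<Rightarrow> (nat \<Rightarrow> real) \<Rightarrow> nat \<Rightarrow> nat \<Rightarrow> real" where
  "absorbed_phase_rate k l \<mu> lam i j =
     (if i = 0 then 0
      else erlang_rate k l \<mu> lam (inv_into (erlang_states k) (phases k) i)
                                 (inv_into (erlang_states k) (phases k) j))"

definition absorbed_phase_process ::
    "'w measure \<Rightarrow> (real \<Rightarrow> 'w \<Rightarrow> nat) \<Rightarrow> nat \<Rightarrow> nat \<Rightarrow> real \<Rightarrow> (nat \<Rightarrow> real) \<Rightarrow> nat \<Rightarrow> bool" where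
  "absorbed_phase_process M L k l \<mu> lam a \<longleftrightarrow>
     markov_process M L UNIV (absorbed_phase_rate k l \<mu> lam) \<and>
     (AE \<omega> in M. L 0 \<omega> = a)"

subsection \<open>The series for the distribution function\<close>

text \<open>The tuples of nonnegative integers indexed by \<open>1, \<dots>, l\<close> with sum \<open>n\<close>.\<close>
definition compositions :: "nat \<Rightarrow> nat \<Rightarrow> (nat \<Rightarrow> nat) set" where
  "compositions l n = {m \<in> {1..l} \<rightarrow>\<^sub>E UNIV. (\<Sum>j=1..l. m j) = n}"

definition busy_series_term ::
    "nat \<Rightarrow> nat \<Rightarrow> real \<Rightarrow> real \<Rightarrow> (nat \<Rightarrow> real) \<Rightarrow> nat \<Rightarrow> real \<Rightarrow> nat \<Rightarrow> real" where
  "busy_series_term k l \<mu> \<Lambda> c a t n =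
     \<Lambda> ^ n * (\<Sum>m\<in>compositions l n.
        (\<Prod>i=1..l. c i ^ m i / fact (m i)) *
        ((real k * \<mu>) ^ (a + k * (\<Sum>j=1..l. j * m j)) / fact (a + k * (\<Sum>j=1..l. j * m j))) *
        integral {0..t} (\<lambda>z. z ^ (a + n + k * (\<Sum>j=1..l. j * m j) - 1) * exp (- (\<Lambda> + real k * \<mu>) * z)))"

end

theory Submission
  imports Defs
begin

text \<open>
  While the server is busy, the number of unfinished phases is a random walk: it goes down by one at
  rate \<open>k * \<mu>\<close> and up by \<open>k * m\<close> at rate \<open>lam m\<close>, so that events occur at the constant total rate
  \<open>K = \<Lambda> + k * \<mu>\<close>. Both probabilities in the theorem are the probability \<open>hit_prob a t\<close> that this
  walk, started from \<open>a\<close>, has reached 0 by time \<open>t\<close>. The proof has an explicit half, which evaluates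
  \<open>hit_prob\<close>, and a probabilistic half, which identifies the two probabilities with it.

  The explicit half uses uniformization. At rate \<open>K\<close> the number of events up to time \<open>t\<close> is Poisson
  and independent of the embedded walk, which gives \<open>hit_prob\<close> as a Poisson mixture of the hitting
  probabilities of the embedded walk. Its derivative is the first-passage density
  \<open>\<Sum>N. w (N + 1) * z ^ N / N! * exp (- K * z)\<close>, where \<open>w (N + 1)\<close> is the total weight of the paths
  which hit 0 for the first time at step \<open>N + 1\<close>. Since the walk goes down only by single steps, the
  ballot theorem applies: among all arrangements of a given collection of jumps with total
  displacement \<open>-a\<close>, the fraction \<open>a / (N + 1)\<close> does not reach 0 before the end
  (\<open>hit_weight_closed_form\<close>). The collection is determined by the numbers \<open>m j\<close> of groups of size
  \<open>j\<close>; the sum over the number of steps becomes the stated series when it is regrouped by the number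
  of groups (\<open>busy_series_sums\<close>).

  In the probabilistic half, the jump rates are given only through errors \<open>o(h)\<close> which need not be
  uniform in the state. Since the total rates are bounded, the semigroup property turns them into
  lower bounds for the transition probabilities which hold for every \<open>h\<close>, and since each row sums to
  one these lower bounds are also almost sharp. So one step of length \<open>h\<close> acts on a function bounded
  by 1 as \<open>1 + h * generator\<close> up to \<open>2 * K\<^sup>2 * h\<^sup>2\<close>, uniformly in the state
  (\<open>generator_approximation\<close>). Because \<open>hit_prob\<close> solves the backward equation, the probability that
  the process observed at the multiples of \<open>h\<close> is seen in 0 within \<open>J\<close> steps differs from
  \<open>hit_prob\<close> at time \<open>J * h\<close> by \<open>O(J * h\<^sup>2)\<close> (\<open>grid_hit_error\<close>). Letting \<open>h\<close> tend to 0 settles the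
  absorbed process (\<open>absorbed_prob\<close>).

  For the queue, the busy period is observed on the grids of mesh \<open>1 / (n + 1)\<close>. By right continuity,
  each path eventually shows the correct first group and the correct answer to the question whether
  the busy period has ended after time \<open>t\<close> (\<open>busy_period_on_grid\<close>). On the grid the
  corresponding event is a disjoint union of events about finitely many times, so the Markov property
  gives its probability (\<open>prob_first_group\<close>). In the limit the law of the first group is
  \<open>lam m / \<Lambda>\<close>, and given this group the busy period has the distribution function
  \<open>hit_prob (m * k)\<close>.
\<close>

section \<open>Short-time estimates for bounded rates\<close>

lemma has_sum_minus:
  fixes f g :: "'a \<Rightarrow> real"
  assumes "(f has_sum a) A" "(g has_sum b) A"
  shows "((\<lambda>x. f x - g x) has_sum (a - b)) A"
  using has_sum_add[OF assms(1) has_sum_uminusI[OF assms(2)]] by simp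

text \<open>
  A transition function whose rates are conservative and have bounded row sums: \<open>r x\<close> is the total
  rate out of \<open>x\<close>. For such rates the infinitesimal description determines the short-time behaviour
  uniformly in the state.
\<close>
locale bounded_rate_chain =
  fixes S :: "'s set" and p :: "real \<Rightarrow> 's \<Rightarrow> 's \<Rightarrow> real" and q :: "'s \<Rightarrow> 's \<Rightarrow> real"
    and r :: "'s \<Rightarrow> real" and K :: real
  assumes transition: "transition_function S p"
    and rates: "has_transition_rates S p q"
    and rate_nonneg: "\<And>x y. x \<in> S \<Longrightarrow> y \<in> S \<Longrightarrow> 0 \<le> q x y"
    and total_rate: "\<And>x. x \<in> S \<Longrightarrow> (q x has_sum r x) (S - {x})"
    and rate_bound: "\<And>x. x \<in> S \<Longrightarrow> r x \<le> K"
begin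

lemma p_nonneg: "0 \<le> t \<Longrightarrow> x \<in> S \<Longrightarrow> y \<in> S \<Longrightarrow> 0 \<le> p t x y"
  using transition by (auto simp: transition_function_def)

lemma p_row_sum: "0 \<le> t \<Longrightarrow> x \<in> S \<Longrightarrow> (p t x has_sum 1) S"
  using transition by (auto simp: transition_function_def)

lemma p_zero: "x \<in> S \<Longrightarrow> y \<in> S \<Longrightarrow> p 0 x y = (if x = y then 1 else 0)"
  using transition by (auto simp: transition_function_def)

lemma chapman_kolmogorov:
  "0 \<le> s \<Longrightarrow> 0 \<le> t \<Longrightarrow> x \<in> S \<Longrightarrow> z \<in> S \<Longrightarrow> ((\<lambda>y. p s x y * p t y z) has_sum p (s + t) x z) S"
  using transition by (auto simp: transition_function_def)

lemma p_le_1: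
  assumes "0 \<le> t" "x \<in> S" "y \<in> S" shows "p t x y \<le> 1"
  using finite_sum_le_has_sum[OF p_row_sum, of t x "{y}"] assms p_nonneg by auto

lemma chapman_kolmogorov_ge:
  assumes "0 \<le> s" "0 \<le> t" "x \<in> S" "z \<in> S" "finite B" "B \<subseteq> S"
  shows "(\<Sum>y\<in>B. p s x y * p t y z) \<le> p (s + t) x z"
  using finite_sum_le_has_sum[OF chapman_kolmogorov[OF assms(1-4)] assms(5,6)] assms p_nonneg
  by auto

lemma total_rate_nonneg: "x \<in> S \<Longrightarrow> 0 \<le> r x"
  using has_sum_nonneg[OF total_rate] rate_nonneg by auto

lemma bound_nonneg: "x \<in> S \<Longrightarrow> 0 \<le> K"
  using total_rate_nonneg rate_bound by force

lemma exit_rate_limit: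
  assumes "x \<in> S"
  shows "((\<lambda>h. (1 - p h x x) / h) \<longlongrightarrow> r x) (at_right 0)"
proof -
  have "(\<lambda>h. p h x x - (1 - r x * h)) \<in> o[at_right 0](\<lambda>h. h)"
    using rates assms infsumI[OF total_rate[OF assms]]
    by (auto simp: has_transition_rates_def)
  then have "((\<lambda>h. (p h x x - (1 - r x * h)) / h) \<longlongrightarrow> 0) (at_right 0)"
    by (rule smalloD_tendsto)
  then have "((\<lambda>h. r x - (p h x x - (1 - r x * h)) / h) \<longlongrightarrow> r x - 0) (at_right 0)"
    by (intro tendsto_intros)
  moreover have "\<forall>\<^sub>F h in at_right 0. r x - (p h x x - (1 - r x * h)) / h = (1 - p h x x) / h"
    using eventually_at_right_less[of "0::real"]
    by eventually_elim (auto simp: field_simps)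
  ultimately show ?thesis by (simp add: tendsto_cong)
qed

lemma jump_rate_limit:
  assumes "x \<in> S" "y \<in> S" "x \<noteq> y"
  shows "((\<lambda>h. p h x y / h) \<longlongrightarrow> q x y) (at_right 0)"
proof -
  have "(\<lambda>h. p h x y - q x y * h) \<in> o[at_right 0](\<lambda>h. h)"
    using rates assms by (auto simp: has_transition_rates_def)
  then have "((\<lambda>h. (p h x y - q x y * h) / h) \<longlongrightarrow> 0) (at_right 0)"
    by (rule smalloD_tendsto)
  then have "((\<lambda>h. q x y + (p h x y - q x y * h) / h) \<longlongrightarrow> q x y + 0) (at_right 0)"
    by (intro tendsto_intros)
  moreover have "\<forall>\<^sub>F h in at_right 0. q x y + (p h x y - q x y * h) / h = p h x y / h"
    using eventually_at_right_less[of "0::real"]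
    by eventually_elim (auto simp: field_simps)
  ultimately show ?thesis by (simp add: tendsto_cong)
qed

lemma stay_prob_power:
  assumes "0 \<le> h" "x \<in> S"
  shows "p h x x ^ n \<le> p (real n * h) x x"
proof (induction n)
  case 0
  then show ?case using p_zero assms by simp
next
  case (Suc n)
  have "p h x x ^ Suc n \<le> p h x x * p (real n * h) x x"
    using Suc p_nonneg[OF assms assms(2)] by (simp add: mult_left_mono)
  also have "\<dots> \<le> p (h + real n * h) x x"
    using chapman_kolmogorov_ge[of h "real n * h" x x "{x}"] assms by simp
  finally show ?case by (simp add: algebra_simps)
qed

lemma filterlim_divide_nat_at_right:
  fixes h :: real assumes "0 < h"
  shows "filterlim (\<lambda>n. h / real (Suc n)) (at_right 0) sequentially"
proof (rule tendsto_imp_filterlim_at_right)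
  show "(\<lambda>n. h / real (Suc n)) \<longlonglongrightarrow> 0"
    using LIMSEQ_Suc[OF lim_const_over_n[of h]] by simp
  show "\<forall>\<^sub>F n in sequentially. 0 < h / real (Suc n)"
    using assms by simp
qed

text \<open>
  Staying at \<open>x\<close> at each of the \<open>n\<close> times \<open>h / n, 2 * h / n, \<dots>, h\<close> has probability at least
  \<open>1 - n * (1 - p (h / n) x x)\<close> by Bernoulli's inequality, and this tends to \<open>1 - r x * h\<close>.
\<close>
lemma stay_prob_lower:
  assumes "0 \<le> h" "x \<in> S"
  shows "1 - r x * h \<le> p h x x"
proof (cases "h = 0")
  case False
  then have h: "0 < h" using assms by simp
  define d where "d n = h / real (Suc n)" for n
  have d: "0 < d n" "real (Suc n) * d n = h" for n using h by (auto simp: d_def)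
  have "(\<lambda>n. 1 - h * ((1 - p (d n) x x) / d n)) \<longlonglongrightarrow> 1 - h * r x"
    using filterlim_compose[OF exit_rate_limit[OF assms(2)] filterlim_divide_nat_at_right[OF h]]
    unfolding d_def by (intro tendsto_intros)
  moreover have "1 - h * ((1 - p (d n) x x) / d n) \<le> p h x x" for n
  proof -
    have hd: "h / d n = real (Suc n)" using d[of n] by (simp add: field_simps)
    have "1 - h * ((1 - p (d n) x x) / d n) = 1 + of_nat (Suc n) * (p (d n) x x - 1)"
      unfolding hd[symmetric] by (simp add: algebra_simps diff_divide_distrib)
    also have "\<dots> \<le> (1 + (p (d n) x x - 1)) ^ Suc n"
      by (rule Bernoulli_inequality) (use p_nonneg[of "d n" x x] d[of n] assms in auto)
    also have "\<dots> \<le> p h x x"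
      using stay_prob_power[of "d n" x "Suc n"] d[of n] assms by simp
    finally show ?thesis .
  qed
  ultimately show ?thesis
    by (metis (no_types, lifting) LIMSEQ_le_const2 mult.commute)
qed (use p_zero assms in auto)

text \<open>
  One way to be at \<open>y\<close> after \<open>n\<close> steps is to wait at \<open>x\<close>, to jump once, and to wait at \<open>y\<close>. There are
  \<open>n\<close> choices for the step of the jump, and the waiting costs at most the factor
  \<open>1 - K * (n * h)\<close>.
\<close>
lemma jump_prob_multistep:
  assumes "0 \<le> h" "x \<in> S" "y \<in> S" "x \<noteq> y"
  shows "real n * p h x y * (1 - K * (real n * h)) \<le> p (real n * h) x y"
proof (induction n)
  case 0
  then show ?case using p_zero assms by simp
next
  case (Suc n)
  let ?P = "p h x y"
  have P: "0 \<le> ?P" using p_nonneg assms by simp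
  have K: "0 \<le> K" using bound_nonneg assms by blast
  have xx: "1 - K * h \<le> p h x x"
    using stay_prob_lower[of h x] rate_bound[of x] assms mult_right_mono[of "r x" K h] by simp
  have yy: "1 - K * (real n * h) \<le> p (real n * h) y y"
    using stay_prob_lower[of "real n * h" y] rate_bound[of y] assms
      mult_right_mono[of "r y" K "real n * h"] by simp
  have nxy: "0 \<le> p (real n * h) x y" "0 \<le> p (real n * h) y y" "0 \<le> p h x x"
    using p_nonneg assms by simp_all
  have ck: "p h x x * p (real n * h) x y + ?P * p (real n * h) y y \<le> p (real (Suc n) * h) x y"
    using chapman_kolmogorov_ge[of h "real n * h" x y "{x, y}"] assms
    by (simp add: algebra_simps)
  show ?case
  proof (cases "K * (real (Suc n) * h) \<le> 1")
    case False
    then have "real (Suc n) * ?P * (1 - K * (real (Suc n) * h)) \<le> 0"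
      using P by (intro mult_nonneg_nonpos) auto
    also have "0 \<le> p (real (Suc n) * h) x y" using p_nonneg assms by simp
    finally show ?thesis .
  next
    case True
    have Kh: "0 \<le> K * h" "0 \<le> K * (real n * h)" using K assms by auto
    have le: "K * h + K * (real n * h) \<le> 1" using True by (simp add: algebra_simps)
    have "real (Suc n) * ?P * (1 - K * (real (Suc n) * h))
        \<le> ?P * (real n * ((1 - K * h) * (1 - K * (real n * h))) + (1 - K * (real n * h)))"
    proof -
      have "0 \<le> ?P * (real n * (K * h) * (K * (real n * h)) + K * h)"
        using P Kh by simp
      then show ?thesis by (simp add: algebra_simps)
    qed
    also have "\<dots> = (1 - K * h) * (real n * ?P * (1 - K * (real n * h)))
        + ?P * (1 - K * (real n * h))" by (simp add: algebra_simps)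
    also have "\<dots> \<le> p h x x * p (real n * h) x y + ?P * p (real n * h) y y"
      using xx yy Suc nxy P le Kh by (intro add_mono mult_mono mult_left_mono) auto
    also note ck
    finally show ?thesis .
  qed
qed

text \<open>
  Subdividing \<open>[0, h]\<close> into \<open>n\<close> steps turns the rate, a limit at 0, into a bound at the fixed time
  \<open>h\<close>.
\<close>
lemma jump_prob_lower:
  assumes "0 \<le> h" "x \<in> S" "y \<in> S" "x \<noteq> y"
  shows "h * q x y * (1 - K * h) \<le> p h x y"
proof (cases "h = 0")
  case False
  then have h: "0 < h" using assms by simp
  define d where "d n = h / real (Suc n)" for n
  have d: "0 < d n" "real (Suc n) * d n = h" for n using h by (auto simp: d_def)
  have "(\<lambda>n. h * (p (d n) x y / d n) * (1 - K * h)) \<longlonglongrightarrow> h * q x y * (1 - K * h)"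
    using filterlim_compose[OF jump_rate_limit[OF assms(2-4)] filterlim_divide_nat_at_right[OF h]]
    unfolding d_def by (intro tendsto_intros)
  moreover have "h * (p (d n) x y / d n) * (1 - K * h) \<le> p h x y" for n
  proof -
    have "h * (p (d n) x y / d n) = real (Suc n) * p (d n) x y"
      unfolding d(2)[of n, symmetric] using d(1)[of n] by simp
    then show ?thesis using jump_prob_multistep[of "d n" x y "Suc n"] d[of n] assms
      by (simp del: of_nat_Suc)
  qed
  ultimately show ?thesis
    by (metis (no_types, lifting) LIMSEQ_le_const2)
qed (use p_zero assms in auto)

lemma summable_weighted:
  assumes "0 \<le> h" "x \<in> S" and "\<And>y. y \<in> S \<Longrightarrow> \<bar>u y\<bar> \<le> C"
  shows "(\<lambda>y. norm (p h x y * u y)) summable_on S"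
proof (rule summable_on_comparison_test)
  show "(\<lambda>y. p h x y * C) summable_on S"
    using p_row_sum[OF assms(1,2)] has_sum_imp_summable summable_on_cmult_left by blast
  show "norm (p h x y * u y) \<le> p h x y * C" if "y \<in> S" for y
    using assms(3)[OF that] p_nonneg[OF assms(1,2) that] by (simp add: abs_mult mult_left_mono)
qed simp

text \<open>
  The two lower bounds for row \<open>x\<close> of the transition matrix add up to \<open>1 - K * r x * h\<^sup>2\<close>, while the
  row itself adds up to 1. So the row is within \<open>K\<^sup>2 * h\<^sup>2\<close> of its lower bound in total variation, and
  the lower bound is within another \<open>K\<^sup>2 * h\<^sup>2\<close> of the row of \<open>1 + h * generator\<close>.
\<close>
lemma generator_approximation:
  assumes h: "0 \<le> h" and x: "x \<in> S" and u: "\<And>y. y \<in> S \<Longrightarrow> \<bar>u y\<bar> \<le> C"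
    and G: "((\<lambda>y. q x y * u y) has_sum G) (S - {x})"
  shows "\<bar>(\<Sum>\<^sub>\<infinity>y\<in>S. p h x y * u y) - (u x + h * (G - r x * u x))\<bar> \<le> 2 * K\<^sup>2 * h\<^sup>2 * C"
proof -
  \<comment> \<open>\<open>B\<close> is the row of lower bounds. It may be negative when \<open>K * h > 1\<close>, which does no harm.\<close>
  define B where "B y = (if y = x then 1 - r x * h else h * q x y * (1 - K * h))" for y
  have split: "S = insert x (S - {x})" using x by auto
  have C: "0 \<le> C" using u[OF x] by linarith
  have r: "0 \<le> r x" "r x \<le> K" using total_rate_nonneg rate_bound x by auto
  have "(B has_sum (h * (1 - K * h) * r x)) (S - {x})"
    using has_sum_cmult_right[OF total_rate[OF x], of "h * (1 - K * h)"]
    by (rule has_sum_cong[THEN iffD1, rotated]) (auto simp: B_def)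
  then have B1: "(B has_sum (B x + h * (1 - K * h) * r x)) S"
    by (subst split) (rule has_sum_insert, auto)
  have "((\<lambda>y. B y * u y) has_sum (h * (1 - K * h) * G)) (S - {x})"
    using has_sum_cmult_right[OF G, of "h * (1 - K * h)"]
    by (rule has_sum_cong[THEN iffD1, rotated]) (auto simp: B_def)
  then have Bu: "((\<lambda>y. B y * u y) has_sum (B x * u x + h * (1 - K * h) * G)) S"
    by (subst split) (rule has_sum_insert, auto)
  have pu: "((\<lambda>y. p h x y * u y) has_sum (\<Sum>\<^sub>\<infinity>y\<in>S. p h x y * u y)) S"
    using abs_summable_summable[OF summable_weighted[OF h x u]] by simp
  have B_le: "B y \<le> p h x y" if "y \<in> S" for y
    using stay_prob_lower[OF h x] jump_prob_lower[OF h x that] by (auto simp: B_def)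
  have d: "((\<lambda>y. p h x y - B y) has_sum (K * h\<^sup>2 * r x)) S"
    using has_sum_minus[OF p_row_sum[OF h x] B1]
    by (simp add: B_def algebra_simps power2_eq_square)
  have du: "((\<lambda>y. (p h x y - B y) * u y) has_sum
      ((\<Sum>\<^sub>\<infinity>y\<in>S. p h x y * u y) - (B x * u x + h * (1 - K * h) * G))) S"
    using has_sum_minus[OF pu Bu] by (simp add: algebra_simps)
  have "\<bar>(\<Sum>\<^sub>\<infinity>y\<in>S. p h x y * u y) - (B x * u x + h * (1 - K * h) * G)\<bar> \<le> K * h\<^sup>2 * r x * C"
  proof (rule abs_leI)
    show "(\<Sum>\<^sub>\<infinity>y\<in>S. p h x y * u y) - (B x * u x + h * (1 - K * h) * G) \<le> K * h\<^sup>2 * r x * C"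
    proof (rule has_sum_mono[OF du has_sum_cmult_left[OF d]])
      show "(p h x y - B y) * u y \<le> (p h x y - B y) * C" if "y \<in> S" for y
        using B_le[OF that] u[OF that] by (intro mult_left_mono) auto
    qed
    show "- ((\<Sum>\<^sub>\<infinity>y\<in>S. p h x y * u y) - (B x * u x + h * (1 - K * h) * G)) \<le> K * h\<^sup>2 * r x * C"
    proof (rule has_sum_mono[OF has_sum_uminusI[OF du] has_sum_cmult_left[OF d]])
      show "- ((p h x y - B y) * u y) \<le> (p h x y - B y) * C" if "y \<in> S" for y
        using B_le[OF that] u[OF that] mult_left_mono[of "- u y" C "p h x y - B y"] by auto
    qed
  qed
  moreover have "\<bar>G\<bar> \<le> r x * C"
  proof (rule abs_leI)
    show "G \<le> r x * C"
      by (rule has_sum_mono[OF G has_sum_cmult_left[OF total_rate[OF x]]])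
        (use u rate_nonneg x in \<open>auto intro!: mult_left_mono simp: abs_le_iff\<close>)
    show "- G \<le> r x * C"
    proof (rule has_sum_mono[OF has_sum_uminusI[OF G] has_sum_cmult_left[OF total_rate[OF x]]])
      show "- (q x y * u y) \<le> q x y * C" if "y \<in> S - {x}" for y
        using that rate_nonneg[OF x, of y] u[of y] mult_left_mono[of "- u y" C "q x y"] by auto
    qed
  qed
  then have "\<bar>K * h\<^sup>2 * G\<bar> \<le> K * h\<^sup>2 * (r x * C)"
    using r by (auto simp: abs_mult intro!: mult_left_mono)
  moreover have "(\<Sum>\<^sub>\<infinity>y\<in>S. p h x y * u y) - (u x + h * (G - r x * u x))
     = ((\<Sum>\<^sub>\<infinity>y\<in>S. p h x y * u y) - (B x * u x + h * (1 - K * h) * G)) - K * h\<^sup>2 * G"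
    by (simp add: B_def algebra_simps power2_eq_square)
  moreover have "K * h\<^sup>2 * (r x * C) \<le> K * h\<^sup>2 * (K * C)"
    using r C by (intro mult_left_mono mult_right_mono) auto
  ultimately show ?thesis by (simp add: power2_eq_square algebra_simps)
qed

end

section \<open>The hitting probability of zero by uniformization\<close>

locale erlang_parameters =
  fixes k l :: nat and \<mu> :: real and lam :: "nat \<Rightarrow> real"
  assumes k_pos: "k \<ge> 1" and l_pos: "l \<ge> 1" and mu_pos: "\<mu> > 0"
    and lam_pos: "\<And>m. m \<in> {1..l} \<Longrightarrow> lam m > 0"
begin

definition phase_rate :: real where
  "phase_rate = real k * \<mu>"

definition arrival_rate :: real where
  "arrival_rate = (\<Sum>m=1..l. lam m)"

definition event_rate :: real where
  "event_rate = arrival_rate + phase_rate"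

lemma phase_rate_pos: "0 < phase_rate"
  using k_pos mu_pos by (simp add: phase_rate_def)

lemma arrival_rate_pos: "0 < arrival_rate"
  unfolding arrival_rate_def using l_pos lam_pos by (intro sum_pos) auto

lemma event_rate_pos: "0 < event_rate"
  using phase_rate_pos arrival_rate_pos by (simp add: event_rate_def)

lemma arrival_sum_mono:
  "(\<And>m. m \<in> {1..l} \<Longrightarrow> f m \<le> g m) \<Longrightarrow> (\<Sum>m=1..l. lam m * f m) \<le> (\<Sum>m=1..l. lam m * g m)"
  using lam_pos by (intro sum_mono mult_left_mono) (auto simp: less_imp_le)

text \<open>
  The generator of the walk at a positive state \<open>i\<close> maps \<open>u\<close> to \<open>step_sum u i - event_rate * u i\<close>.
\<close>
definition step_sum :: "(nat \<Rightarrow> real) \<Rightarrow> nat \<Rightarrow> real" where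
  "step_sum u i = phase_rate * u (i - 1) + (\<Sum>m=1..l. lam m * u (i + k * m))"

lemma step_sum_add: "step_sum (\<lambda>j. u j + v j) i = step_sum u i + step_sum v i"
  by (simp add: step_sum_def algebra_simps sum.distrib)

lemma step_sum_cmult: "step_sum (\<lambda>j. x * u j) i = x * step_sum u i"
  by (simp add: step_sum_def algebra_simps sum_distrib_left)

lemma step_sum_diff: "step_sum (\<lambda>j. u j - v j) i = step_sum u i - step_sum v i"
  by (simp add: step_sum_def algebra_simps sum_subtractf)

lemma step_sum_const: "step_sum (\<lambda>j. x) i = event_rate * x"
  by (simp add: step_sum_def event_rate_def arrival_rate_def algebra_simps sum_distrib_left)

lemma step_sum_sum: "step_sum (\<lambda>j. \<Sum>n\<in>A. f n j) i = (\<Sum>n\<in>A. step_sum (f n) i)"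
  by (induction A rule: infinite_finite_induct)
    (simp_all add: step_sum_add, simp_all add: step_sum_def)

lemma step_sum_mono: "(\<And>j. u j \<le> v j) \<Longrightarrow> step_sum u i \<le> step_sum v i"
  unfolding step_sum_def using phase_rate_pos
  by (intro add_mono arrival_sum_mono mult_left_mono) auto

lemma step_sum_sums:
  assumes "\<And>j. (\<lambda>N. f N j) sums s j"
  shows "(\<lambda>N. step_sum (f N) i) sums step_sum s i"
  unfolding step_sum_def by (intro sums_add sums_mult sums_sum assms)

lemma abs_step_sum_le:
  assumes "\<And>j. \<bar>u j\<bar> \<le> C"
  shows "\<bar>step_sum u i\<bar> \<le> event_rate * C"
proof (rule abs_leI)
  show "step_sum u i \<le> event_rate * C"
    using step_sum_mono[of u "\<lambda>_. C" i] assms by (auto simp: step_sum_const abs_le_iff)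
  show "- step_sum u i \<le> event_rate * C"
    using step_sum_mono[of "\<lambda>j. -1 * u j" "\<lambda>_. C" i] assms
    unfolding step_sum_cmult by (auto simp: step_sum_const abs_le_iff)
qed

text \<open>
  The sum, over all paths from \<open>i\<close> which hit 0 for the first time at step \<open>N\<close>, of the product of the
  rates of their jumps.
\<close>
fun hit_weight :: "nat \<Rightarrow> nat \<Rightarrow> real" where
  "hit_weight 0 i = (if i = 0 then 1 else 0)"
| "hit_weight (Suc N) i = (if i = 0 then 0 else step_sum (hit_weight N) i)"

text \<open>
  The probability that the embedded walk, which takes each jump with probability its rate divided by
  \<open>event_rate\<close>, hits 0 within \<open>N\<close> steps.
\<close>
definition hit_within :: "nat \<Rightarrow> nat \<Rightarrow> real" where
  "hit_within N i = (\<Sum>j\<le>N. hit_weight j i / event_rate ^ j)"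

lemma hit_weight_nonneg: "0 \<le> hit_weight N i"
proof (induction N arbitrary: i)
  case (Suc N)
  then show ?case using step_sum_mono[of "\<lambda>_. 0" "hit_weight N" i] by (simp add: step_sum_const)
qed simp

lemma hit_within_0: "hit_within 0 i = (if i = 0 then 1 else 0)"
  by (simp add: hit_within_def)

lemma hit_within_at_0: "hit_within N 0 = 1"
  by (induction N) (simp_all add: hit_within_def)

lemma hit_within_Suc_diff:
  "hit_within (Suc N) i - hit_within N i = hit_weight (Suc N) i / event_rate ^ Suc N"
  by (simp add: hit_within_def)

text \<open>
  Decomposition by the first step. This form, rather than the definition, shows that the values stay
  below 1 and produces the backward equation for \<open>hit_prob\<close>.
\<close>
lemma hit_within_Suc:
  assumes "i \<noteq> 0"
  shows "hit_within (Suc N) i = step_sum (hit_within N) i / event_rate"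
proof -
  have "hit_within (Suc N) i = (\<Sum>j\<le>N. hit_weight (Suc j) i / event_rate ^ Suc j)"
    unfolding hit_within_def by (subst sum.atMost_Suc_shift) (use assms in simp)
  also have "\<dots> = (\<Sum>j\<le>N. step_sum (\<lambda>i. inverse (event_rate ^ j) * hit_weight j i) i / event_rate)"
    using assms unfolding step_sum_cmult by (intro sum.cong) (auto simp: field_simps)
  also have "\<dots> = step_sum (\<lambda>i. \<Sum>j\<le>N. inverse (event_rate ^ j) * hit_weight j i) i / event_rate"
    unfolding step_sum_sum by (simp add: sum_divide_distrib)
  also have "(\<lambda>i. \<Sum>j\<le>N. inverse (event_rate ^ j) * hit_weight j i) = hit_within N"
    by (simp add: hit_within_def fun_eq_iff field_simps)
  finally show ?thesis .
qed

lemma hit_within_nonneg: "0 \<le> hit_within N i"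
  unfolding hit_within_def using hit_weight_nonneg event_rate_pos
  by (intro sum_nonneg divide_nonneg_nonneg) auto

lemma hit_within_le_1: "hit_within N i \<le> 1"
proof (induction N arbitrary: i)
  case (Suc N)
  show ?case
  proof (cases "i = 0")
    case False
    have "step_sum (hit_within N) i \<le> event_rate"
      using step_sum_mono[of "hit_within N" "\<lambda>_. 1" i] Suc by (simp add: step_sum_const)
    then show ?thesis using False event_rate_pos by (simp add: hit_within_Suc)
  qed (simp add: hit_within_at_0)
qed (simp add: hit_within_0)

definition hit_coeff :: "nat \<Rightarrow> nat \<Rightarrow> real" where
  "hit_coeff i N = hit_within N i * event_rate ^ N / fact N"

text \<open>
  The Poisson mixture of the hitting probabilities of the embedded walk. The defining series converges
  for negative times as well, so that derivatives at time 0 are two-sided.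
\<close>
definition hit_prob :: "nat \<Rightarrow> real \<Rightarrow> real" where
  "hit_prob i t = (\<Sum>N. hit_coeff i N * t ^ N) * exp (- (event_rate * t))"

lemma exp_coeff_sums: "(\<lambda>N. event_rate ^ N / fact N * t ^ N) sums exp (event_rate * t)" for t :: real
  using exp_converges[of "event_rate * t"] by (simp add: power_mult_distrib field_simps)

lemma hit_coeff_nonneg: "0 \<le> hit_coeff i N"
  using hit_within_nonneg event_rate_pos by (simp add: hit_coeff_def)

lemma hit_coeff_le: "hit_coeff i N \<le> event_rate ^ N / fact N"
  unfolding hit_coeff_def using hit_within_le_1 event_rate_pos
  by (intro divide_right_mono) (auto simp: mult_left_le_one_le hit_within_nonneg)

lemma summable_hit_coeff: "summable (\<lambda>N. hit_coeff i N * t ^ N)" for t :: real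
proof (rule summable_comparison_test')
  show "summable (\<lambda>N. event_rate ^ N / fact N * \<bar>t\<bar> ^ N)"
    using exp_coeff_sums sums_summable by blast
  show "norm (hit_coeff i N * t ^ N) \<le> event_rate ^ N / fact N * \<bar>t\<bar> ^ N" for N
    using mult_right_mono[OF hit_coeff_le[of i N], of "\<bar>t\<bar> ^ N"] hit_coeff_nonneg[of i N]
    by (simp add: abs_mult power_abs)
qed

lemma hit_prob_at_0: "hit_prob 0 t = 1"
proof -
  have "(\<lambda>N. hit_coeff 0 N * t ^ N) sums exp (event_rate * t)"
    using exp_coeff_sums[of t] by (simp add: hit_coeff_def hit_within_at_0)
  then show ?thesis by (simp add: hit_prob_def sums_iff flip: exp_add)
qed

lemma hit_prob_time_0: "i \<noteq> 0 \<Longrightarrow> hit_prob i 0 = 0"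
  unfolding hit_prob_def powser_zero by (simp add: hit_coeff_def hit_within_0)

lemma hit_prob_nonneg: "0 \<le> t \<Longrightarrow> 0 \<le> hit_prob i t"
  unfolding hit_prob_def
  by (intro mult_nonneg_nonneg suminf_nonneg summable_hit_coeff) (auto simp: hit_coeff_nonneg)

lemma hit_prob_le_1:
  assumes "0 \<le> t" shows "hit_prob i t \<le> 1"
proof -
  have "(\<Sum>N. hit_coeff i N * t ^ N) \<le> exp (event_rate * t)"
    unfolding sums_unique[OF exp_coeff_sums]
    by (intro suminf_le summable_hit_coeff sums_summable[OF exp_coeff_sums] mult_right_mono hit_coeff_le)
      (use assms in auto)
  then have "hit_prob i t \<le> exp (event_rate * t) * exp (- (event_rate * t))"
    unfolding hit_prob_def by (intro mult_right_mono) auto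
  then show ?thesis by (simp flip: exp_add)
qed

lemma diffs_hit_coeff_eq:
  "diffs (hit_coeff i) N = event_rate ^ Suc N / fact N * hit_within (Suc N) i"
  unfolding diffs_def hit_coeff_def fact_Suc by (simp del: of_nat_Suc)

lemma diffs_hit_coeff:
  assumes "i \<noteq> 0"
  shows "diffs (hit_coeff i) N = step_sum (\<lambda>j. hit_coeff j N) i"
proof -
  have "diffs (hit_coeff i) N = event_rate ^ N / fact N * (event_rate * hit_within (Suc N) i)"
    by (simp add: diffs_hit_coeff_eq)
  also have "\<dots> = step_sum (\<lambda>j. event_rate ^ N / fact N * hit_within N j) i"
    using event_rate_pos unfolding step_sum_cmult by (simp add: hit_within_Suc[OF assms])
  finally show ?thesis by (simp add: hit_coeff_def mult.commute)
qed

lemma hit_series_derivative: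
  assumes "i \<noteq> 0"
  shows "((\<lambda>t. \<Sum>N. hit_coeff i N * t ^ N) has_real_derivative
    step_sum (\<lambda>j. \<Sum>N. hit_coeff j N * t ^ N) i) (at t)"
proof -
  have "((\<lambda>t. \<Sum>N. hit_coeff i N * t ^ N) has_real_derivative
      (\<Sum>N. diffs (hit_coeff i) N * t ^ N)) (at t)"
    by (rule termdiffs_strong_converges_everywhere) (rule summable_hit_coeff)
  moreover have "(\<lambda>N. diffs (hit_coeff i) N * t ^ N) sums step_sum (\<lambda>j. \<Sum>N. hit_coeff j N * t ^ N) i"
  proof -
    have "diffs (hit_coeff i) N * t ^ N = step_sum (\<lambda>j. hit_coeff j N * t ^ N) i" for N
      using step_sum_cmult[of "t ^ N" "\<lambda>j. hit_coeff j N" i]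
      by (simp add: diffs_hit_coeff[OF assms] mult.commute)
    then show ?thesis
      by (simp only:) (intro step_sum_sums summable_sums summable_hit_coeff)
  qed
  ultimately show ?thesis by (simp add: sums_iff)
qed

text \<open>
  The backward equation. Differentiating the power series shifts the coefficient index by one, and the
  decomposition by the first step turns this shift into \<open>step_sum\<close>.
\<close>
lemma hit_prob_derivative:
  assumes "i \<noteq> 0"
  shows "(hit_prob i has_real_derivative
    step_sum (\<lambda>j. hit_prob j t) i - event_rate * hit_prob i t) (at t)"
proof -
  have "((\<lambda>t. (\<Sum>N. hit_coeff i N * t ^ N) * exp (- (event_rate * t))) has_real_derivative
      step_sum (\<lambda>j. \<Sum>N. hit_coeff j N * t ^ N) i * exp (- (event_rate * t)) +
      exp (- (event_rate * t)) * (- (event_rate * 1)) * (\<Sum>N. hit_coeff i N * t ^ N)) (at t)"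
    by (intro DERIV_mult hit_series_derivative[OF assms] derivative_intros)
      (auto intro!: derivative_eq_intros)
  moreover have "step_sum (\<lambda>j. hit_prob j t) i =
      exp (- (event_rate * t)) * step_sum (\<lambda>j. \<Sum>N. hit_coeff j N * t ^ N) i"
    unfolding hit_prob_def by (subst step_sum_cmult[symmetric]) (simp add: mult.commute)
  ultimately show ?thesis
    unfolding hit_prob_def[abs_def] by (simp add: algebra_simps)
qed

lemma hit_prob_lipschitz:
  assumes "0 \<le> s" "s \<le> t"
  shows "\<bar>hit_prob i t - hit_prob i s\<bar> \<le> 2 * event_rate * (t - s)"
proof (cases "i = 0 \<or> s = t")
  case False
  then have i: "i \<noteq> 0" and st: "s < t" using assms by auto
  obtain z where z: "s < z" "z < t"
    "hit_prob i t - hit_prob i s = (t - s) * (step_sum (\<lambda>j. hit_prob j z) i - event_rate * hit_prob i z)"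
    using MVT2[OF st hit_prob_derivative[OF i]] by blast
  have "\<bar>step_sum (\<lambda>j. hit_prob j z) i\<bar> \<le> event_rate * 1"
    using hit_prob_nonneg[of z] hit_prob_le_1[of z] z assms by (intro abs_step_sum_le) auto
  moreover have "\<bar>event_rate * hit_prob i z\<bar> \<le> event_rate * 1"
    using hit_prob_nonneg[of z i] hit_prob_le_1[of z i] z assms event_rate_pos
    by (auto simp: abs_mult)
  ultimately have "\<bar>step_sum (\<lambda>j. hit_prob j z) i - event_rate * hit_prob i z\<bar> \<le> 2 * event_rate"
    by linarith
  then show ?thesis unfolding z(3) using st
    by (simp add: abs_mult mult.commute mult_left_mono)
qed (use assms event_rate_pos in \<open>auto simp: hit_prob_at_0\<close>)

text \<open>
  The derivative of \<open>hit_prob\<close> is the generator applied to \<open>hit_prob\<close>, and the generator has norm at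
  most \<open>2 * event_rate\<close>; so the values are Lipschitz in time with constant \<open>2 * event_rate\<close>, and the
  derivative with constant \<open>4 * event_rate\<^sup>2\<close>, both uniformly in \<open>i\<close>.
\<close>
lemma hit_prob_taylor:
  assumes "0 \<le> t" "0 \<le> h" "i \<noteq> 0"
  shows "\<bar>hit_prob i (t + h) - (hit_prob i t + h * (step_sum (\<lambda>j. hit_prob j t) i - event_rate * hit_prob i t))\<bar>
    \<le> 4 * event_rate\<^sup>2 * h\<^sup>2"
proof (cases "h = 0")
  case False
  then have th: "t < t + h" using assms by auto
  define A where "A z = step_sum (\<lambda>j. hit_prob j z) i - event_rate * hit_prob i z" for z
  obtain z where z: "t < z" "z < t + h" "hit_prob i (t + h) - hit_prob i t = h * A z"
    using MVT2[OF th hit_prob_derivative[OF assms(3)]] unfolding A_def by auto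
  have lip: "\<bar>hit_prob j z - hit_prob j t\<bar> \<le> 2 * event_rate * h" for j
  proof -
    have "\<bar>hit_prob j z - hit_prob j t\<bar> \<le> 2 * event_rate * (z - t)"
      using hit_prob_lipschitz[of t z j] z assms by auto
    also have "\<dots> \<le> 2 * event_rate * h" using z event_rate_pos by (intro mult_left_mono) auto
    finally show ?thesis .
  qed
  have "\<bar>step_sum (\<lambda>j. hit_prob j z - hit_prob j t) i\<bar> \<le> event_rate * (2 * event_rate * h)"
    by (rule abs_step_sum_le) (rule lip)
  moreover have "\<bar>event_rate * (hit_prob i z - hit_prob i t)\<bar> \<le> event_rate * (2 * event_rate * h)"
    using lip[of i] event_rate_pos by (simp add: abs_mult)
  moreover have "A z - A t = step_sum (\<lambda>j. hit_prob j z - hit_prob j t) i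
      - event_rate * (hit_prob i z - hit_prob i t)"
    by (simp add: A_def step_sum_diff algebra_simps)
  ultimately have "\<bar>A z - A t\<bar> \<le> 4 * event_rate\<^sup>2 * h"
    by (simp add: power2_eq_square algebra_simps)
  then have "h * \<bar>A z - A t\<bar> \<le> h * (4 * event_rate\<^sup>2 * h)"
    using assms by (intro mult_left_mono)
  moreover have "hit_prob i (t + h) - (hit_prob i t + h * A t) = h * (A z - A t)"
    using z(3) by (simp add: algebra_simps)
  moreover have "h * (4 * event_rate\<^sup>2 * h) = 4 * event_rate\<^sup>2 * h\<^sup>2"
    by (simp add: power2_eq_square)
  ultimately show ?thesis using assms(2) unfolding A_def
    by (simp add: abs_mult)
qed simp

text \<open>
  The first-passage density. The exponential factor makes the derivative of the Poisson mixture
  telescope to the increments \<open>hit_within (Suc N) i - hit_within N i\<close>.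
\<close>
lemma hit_prob_derivative_series:
  assumes "i \<noteq> 0"
  shows "(\<lambda>N. hit_weight (Suc N) i / fact N * t ^ N * exp (- (event_rate * t))) sums
    (step_sum (\<lambda>j. hit_prob j t) i - event_rate * hit_prob i t)"
proof -
  define E where "E = exp (- (event_rate * t))"
  have "(\<lambda>N. step_sum (\<lambda>j. hit_coeff j N * t ^ N) i * E - event_rate * (hit_coeff i N * t ^ N * E)) sums
    (step_sum (\<lambda>j. \<Sum>N. hit_coeff j N * t ^ N) i * E - event_rate * ((\<Sum>N. hit_coeff i N * t ^ N) * E))"
    by (intro sums_diff sums_mult sums_mult2 step_sum_sums summable_sums summable_hit_coeff)
  moreover have "step_sum (\<lambda>j. hit_coeff j N * t ^ N) i * E - event_rate * (hit_coeff i N * t ^ N * E)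
      = hit_weight (Suc N) i / fact N * t ^ N * E" for N
  proof -
    have "step_sum (\<lambda>j. hit_coeff j N * t ^ N) i = diffs (hit_coeff i) N * t ^ N"
      using step_sum_cmult[of "t ^ N" "\<lambda>j. hit_coeff j N" i]
      by (simp add: diffs_hit_coeff[OF assms] mult.commute)
    moreover have "diffs (hit_coeff i) N - event_rate * hit_coeff i N
        = event_rate ^ Suc N / fact N * (hit_within (Suc N) i - hit_within N i)"
      by (simp add: diffs_hit_coeff_eq hit_coeff_def algebra_simps diff_divide_distrib)
    then have "diffs (hit_coeff i) N = event_rate * hit_coeff i N + hit_weight (Suc N) i / fact N"
      using event_rate_pos unfolding hit_within_Suc_diff by simp
    ultimately show ?thesis by (simp add: algebra_simps)
  qed
  moreover have "step_sum (\<lambda>j. \<Sum>N. hit_coeff j N * t ^ N) i * E = step_sum (\<lambda>j. hit_prob j t) i"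
    unfolding hit_prob_def E_def by (subst mult.commute, subst step_sum_cmult[symmetric]) (simp add: mult.commute)
  ultimately show ?thesis by (simp add: E_def hit_prob_def)
qed

lemma hit_weight_le: "hit_weight N i \<le> event_rate ^ N"
proof (induction N arbitrary: i)
  case (Suc N)
  then show ?case using step_sum_mono[of "hit_weight N" "\<lambda>_. event_rate ^ N" i] event_rate_pos
    by (simp add: step_sum_const)
qed simp

text \<open>
  Integrating the density term by term is justified by uniform convergence on \<open>{0..t}\<close>: the
  density series is dominated there by an exponential series.
\<close>
lemma hit_prob_integral_series:
  assumes "i \<noteq> 0" "0 \<le> t"
  shows "(\<lambda>N. hit_weight (Suc N) i / fact N *
      integral {0..t} (\<lambda>z. z ^ N * exp (- event_rate * z))) sums hit_prob i t"
proof -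
  define f where "f N z = hit_weight (Suc N) i / fact N * z ^ N * exp (- (event_rate * z))" for N z
  define D where "D z = step_sum (\<lambda>j. hit_prob j z) i - event_rate * hit_prob i z" for z
  have fs: "f N z = hit_weight (Suc N) i / fact N * (z ^ N * exp (- event_rate * z))" for N z
    by (simp add: f_def)
  have "uniform_limit {0..t} (\<lambda>n z. \<Sum>N<n. f N z) (\<lambda>z. \<Sum>N. f N z) sequentially"
  proof (rule Weierstrass_m_test)
    show "norm (f N z) \<le> event_rate * (event_rate ^ N / fact N * t ^ N)" if "z \<in> {0..t}" for N z
    proof -
      have "norm (f N z) = hit_weight (Suc N) i / fact N * z ^ N * exp (- (event_rate * z))"
        using that hit_weight_nonneg[of "Suc N" i] by (simp add: f_def abs_mult)
      also have "\<dots> \<le> event_rate ^ Suc N / fact N * t ^ N * 1"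
        using that hit_weight_le[of "Suc N" i] hit_weight_nonneg[of "Suc N" i] event_rate_pos
        by (intro mult_mono divide_right_mono power_mono) auto
      finally show ?thesis by simp
    qed
    show "summable (\<lambda>N. event_rate * (event_rate ^ N / fact N * t ^ N))"
      using exp_coeff_sums sums_summable summable_mult by blast
  qed
  moreover have "(\<lambda>z. \<Sum>N. f N z) = D"
    using hit_prob_derivative_series[OF assms(1)] by (auto simp: f_def D_def sums_iff)
  ultimately have "uniform_limit {0..t} (\<lambda>n z. \<Sum>N<n. f N z) D sequentially" by simp
  then obtain I J where IJ: "\<And>n. ((\<lambda>z. \<Sum>N<n. f N z) has_integral I n) {0..t}"
    "(D has_integral J) {0..t}" "I \<longlonglongrightarrow> J"
    by (rule uniform_limit_integral) (auto simp: f_def intro!: continuous_intros)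
  have "(D has_integral (hit_prob i t - hit_prob i 0)) {0..t}"
    using assms(2) hit_prob_derivative[OF assms(1)]
    by (intro fundamental_theorem_of_calculus)
      (auto simp: D_def simp flip: has_real_derivative_iff_has_vector_derivative
        intro: has_field_derivative_at_within)
  then have J: "J = hit_prob i t"
    using IJ(2) hit_prob_time_0[OF assms(1)] by (simp add: has_integral_unique)
  have "I n = (\<Sum>N<n. hit_weight (Suc N) i / fact N * integral {0..t} (\<lambda>z. z ^ N * exp (- event_rate * z)))" for n
  proof -
    have "I n = integral {0..t} (\<lambda>z. \<Sum>N<n. f N z)" by (rule integral_unique[OF IJ(1), symmetric])
    also have "\<dots> = (\<Sum>N<n. integral {0..t} (f N))"
      by (rule integral_sum) (auto simp: f_def intro!: integrable_continuous_real continuous_intros)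
    also have "\<dots> = (\<Sum>N<n. hit_weight (Suc N) i / fact N * integral {0..t} (\<lambda>z. z ^ N * exp (- event_rate * z)))"
      by (simp add: fs[abs_def])
    finally show ?thesis .
  qed
  then have "I = (\<lambda>n. \<Sum>N<n. hit_weight (Suc N) i / fact N * integral {0..t} (\<lambda>z. z ^ N * exp (- event_rate * z)))"
    by auto
  then show ?thesis using IJ(3) J by (simp add: sums_def)
qed

end

section \<open>The closed form of the series\<close>

context erlang_parameters
begin

definition group_counts :: "(nat \<Rightarrow> nat) set" where
  "group_counts = {1..l} \<rightarrow>\<^sub>E UNIV"

definition groups :: "(nat \<Rightarrow> nat) \<Rightarrow> nat" where
  "groups m = (\<Sum>j=1..l. m j)"

definition customers :: "(nat \<Rightarrow> nat) \<Rightarrow> nat" where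
  "customers m = (\<Sum>j=1..l. j * m j)"

text \<open>
  A path from \<open>i\<close> to 0 with \<open>m j\<close> arriving groups of size \<open>j\<close> must complete \<open>i + k * customers m\<close>
  phases; its number of steps is this number plus the number of groups.
\<close>
definition counts_with_steps :: "nat \<Rightarrow> nat \<Rightarrow> (nat \<Rightarrow> nat) set" where
  "counts_with_steps i N = {m \<in> group_counts. i + groups m + k * customers m = N}"

text \<open>
  Up to the factor \<open>fact (N - 1)\<close> times \<open>i\<close>, where \<open>N\<close> is the number of steps, this is the total
  weight of the paths with group counts \<open>m\<close> which hit 0 only at their end: the product of the rates,
  divided by the factorials that count the arrangements of equal jumps.
\<close>
definition count_weight :: "nat \<Rightarrow> (nat \<Rightarrow> nat) \<Rightarrow> real" where
  "count_weight i m = (\<Prod>j=1..l. lam j ^ m j / fact (m j)) *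
     (phase_rate ^ (i + k * customers m) / fact (i + k * customers m))"

lemma count_weight_nonneg: "0 \<le> count_weight i m"
  unfolding count_weight_def using lam_pos phase_rate_pos
  by (intro mult_nonneg_nonneg prod_nonneg divide_nonneg_nonneg) (auto simp: less_imp_le)

lemma finite_groups_le: "finite {m \<in> group_counts. groups m \<le> N}"
proof (rule finite_subset)
  show "{m \<in> group_counts. groups m \<le> N} \<subseteq> {1..l} \<rightarrow>\<^sub>E {..N}"
  proof
    fix m assume "m \<in> {m \<in> group_counts. groups m \<le> N}"
    then have m: "m \<in> group_counts" "groups m \<le> N" by auto
    have "m j \<le> N" if "j \<in> {1..l}" for j
      using member_le_sum[OF that, of m] m(2) by (auto simp: groups_def)
    then show "m \<in> {1..l} \<rightarrow>\<^sub>E {..N}" using m(1) by (auto simp: group_counts_def PiE_iff)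
  qed
  show "finite ({1..l} \<rightarrow>\<^sub>E {..N})" by (intro finite_PiE) auto
qed

lemma finite_counts: "finite (counts_with_steps i N)"
  by (rule finite_subset[OF _ finite_groups_le[of N]]) (auto simp: counts_with_steps_def)

lemma count_weight_service:
  assumes "i \<noteq> 0"
  shows "phase_rate * count_weight (i - 1) m = real (i + k * customers m) * count_weight i m"
proof -
  define d where "d = i - 1 + k * customers m"
  have "i + k * customers m = Suc d" using assms by (simp add: d_def)
  then show ?thesis unfolding count_weight_def d_def[symmetric]
    by (simp add: fact_Suc del: of_nat_Suc)
qed

text \<open>
  The effect of one more group of size \<open>j\<close> on the quantities in the closed form. In the weight, the
  starting point \<open>i + k * j\<close> after the arrival and the additional customers compensate each other.
\<close>
lemma add_group:
  assumes "j \<in> {1..l}"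
  shows "groups (m(j := Suc (m j))) = Suc (groups m)"
    and "customers (m(j := Suc (m j))) = customers m + j"
    and "lam j * count_weight (i + k * j) m =
      real (Suc (m j)) * count_weight i (m(j := Suc (m j)))"
proof -
  have upd: "(\<Sum>n\<in>{1..l} - {j}. f n ((m(j := Suc (m j))) n)) = (\<Sum>n\<in>{1..l} - {j}. f n (m n))"
    for f :: "nat \<Rightarrow> nat \<Rightarrow> nat" by (intro sum.cong) auto
  have updp: "(\<Prod>n\<in>{1..l} - {j}. f n ((m(j := Suc (m j))) n)) = (\<Prod>n\<in>{1..l} - {j}. f n (m n))"
    for f :: "nat \<Rightarrow> nat \<Rightarrow> real" by (intro prod.cong) auto
  show "groups (m(j := Suc (m j))) = Suc (groups m)"
    using assms upd[of "\<lambda>n x. x"] unfolding groups_def by (simp add: sum.remove[of _ j])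
  show c: "customers (m(j := Suc (m j))) = customers m + j"
    using assms upd[of "\<lambda>n x. n * x"] unfolding customers_def by (simp add: sum.remove[of _ j])
  have d: "i + k * (customers m + j) = i + k * j + k * customers m"
    by (simp add: algebra_simps)
  have "real (Suc (m j)) * (\<Prod>n=1..l. lam n ^ (m(j := Suc (m j))) n / fact ((m(j := Suc (m j))) n))
      = lam j * (\<Prod>n=1..l. lam n ^ m n / fact (m n))"
  proof -
    have split: "prod f {1..l} = f j * prod f ({1..l} - {j})" for f :: "nat \<Rightarrow> real"
      using assms by (intro prod.remove) auto
    show ?thesis
      unfolding split updp[of "\<lambda>n x. lam n ^ x / fact x"] by (simp add: fact_Suc del: of_nat_Suc)
  qed
  then show "lam j * count_weight (i + k * j) m =
      real (Suc (m j)) * count_weight i (m(j := Suc (m j)))"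
    unfolding count_weight_def c d by (simp only: mult.assoc[symmetric])
qed

text \<open>
  Removing one group of size \<open>j\<close> from the counts is the effect of a first step which brings such a
  group. Counts without a group of this size do not occur as images, but they have factor
  \<open>m j = 0\<close>.
\<close>
lemma sum_counts_arrival:
  assumes j: "j \<in> {1..l}"
  shows "lam j * (\<Sum>m\<in>counts_with_steps (i + k * j) N. count_weight (i + k * j) m) =
    (\<Sum>m\<in>counts_with_steps i (Suc N). real (m j) * count_weight i m)"
proof -
  have "(\<Sum>m\<in>counts_with_steps i (Suc N). real (m j) * count_weight i m)
      = (\<Sum>m\<in>{m \<in> counts_with_steps i (Suc N). m j \<noteq> 0}. real (m j) * count_weight i m)"
    by (rule sum.mono_neutral_right) (auto simp: finite_counts)
  also have "\<dots> = (\<Sum>m\<in>counts_with_steps (i + k * j) N. lam j * count_weight (i + k * j) m)"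
  proof (rule sum.reindex_bij_witness[of _ "\<lambda>m. m(j := Suc (m j))" "\<lambda>m. m(j := m j - 1)"])
    fix m assume "m \<in> {m \<in> counts_with_steps i (Suc N). m j \<noteq> 0}"
    then have m: "m \<in> group_counts" "i + groups m + k * customers m = Suc N" "m j \<noteq> 0"
      by (auto simp: counts_with_steps_def)
    define m' where "m' = m(j := m j - 1)"
    have m': "m = m'(j := Suc (m' j))" using m(3) by (simp add: m'_def)
    then show "(m(j := m j - 1))(j := Suc ((m(j := m j - 1)) j)) = m" by (simp add: m'_def)
    have "m' \<in> group_counts" using m(1) j by (auto simp: m'_def group_counts_def PiE_iff extensional_def)
    moreover have "i + k * j + groups m' + k * customers m' = N"
      using m(2) add_group(1,2)[OF j, of m'] unfolding m'[symmetric] by (simp add: algebra_simps)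
    ultimately show "m(j := m j - 1) \<in> counts_with_steps (i + k * j) N" by (simp add: counts_with_steps_def m'_def)
    show "lam j * count_weight (i + k * j) (m(j := m j - 1)) = real (m j) * count_weight i m"
      using add_group(3)[OF j, of i m'] m(3) unfolding m'[symmetric] by (simp add: m'_def)
  next
    fix m assume "m \<in> counts_with_steps (i + k * j) N"
    then have m: "m \<in> group_counts" "i + k * j + groups m + k * customers m = N"
      by (auto simp: counts_with_steps_def)
    show "(m(j := Suc (m j)))(j := (m(j := Suc (m j))) j - 1) = m" by simp
    have "m(j := Suc (m j)) \<in> group_counts"
      using m(1) j by (auto simp: group_counts_def PiE_iff extensional_def)
    moreover have "i + groups (m(j := Suc (m j))) + k * customers (m(j := Suc (m j))) = Suc N"
      using m(2) unfolding add_group(1,2)[OF j] by (simp add: algebra_simps)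
    ultimately show "m(j := Suc (m j)) \<in> {m \<in> counts_with_steps i (Suc N). m j \<noteq> 0}"
      by (simp add: counts_with_steps_def)
  qed
  finally show ?thesis by (simp add: sum_distrib_left)
qed

definition no_groups :: "nat \<Rightarrow> nat" where
  "no_groups = (\<lambda>j\<in>{1..l}. 0)"

lemma no_groups: "groups no_groups = 0" "customers no_groups = 0" "no_groups \<in> group_counts"
  by (auto simp: no_groups_def groups_def customers_def group_counts_def)

lemma no_groups_unique: "m \<in> group_counts \<Longrightarrow> groups m = 0 \<Longrightarrow> m = no_groups"
  by (auto simp: no_groups_def groups_def group_counts_def PiE_iff extensional_def fun_eq_iff)

lemma counts_one_step: "counts_with_steps 1 1 = {no_groups}"
  using no_groups by (auto simp: counts_with_steps_def dest: no_groups_unique)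

lemma counts_none: "1 < i \<Longrightarrow> counts_with_steps i 1 = {}"
  by (auto simp: counts_with_steps_def)

text \<open>
  The ballot theorem for a walk with downward jumps of size one, in weighted form. The right-hand side
  satisfies the recursion by the first step: with \<open>d = i + k * customers m\<close> services the
  contributions of a service and of the groups to the count \<open>m\<close> are proportional to \<open>(i - 1) * d\<close>
  and \<open>(i + k * j) * m j\<close>, and these add up to \<open>i\<close> times one less than the
  number of steps.
\<close>
lemma hit_weight_closed_form:
  "hit_weight (Suc N) i = real i * fact N * (\<Sum>m\<in>counts_with_steps i (Suc N). count_weight i m)"
proof (induction N arbitrary: i)
  case 0
  have "(\<Sum>m=1..l. lam m * hit_weight 0 (i + k * m)) = 0"
    using k_pos by (intro sum.neutral) auto
  then have "hit_weight (Suc 0) i = (if i = 1 then phase_rate else 0)"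
    by (auto simp: step_sum_def)
  moreover have "count_weight 1 no_groups = phase_rate"
    by (simp add: count_weight_def no_groups(2)) (simp add: no_groups_def)
  moreover have "i = 0 \<or> i = 1 \<or> 1 < i" by linarith
  ultimately show ?case
    by (elim disjE) (simp_all add: counts_one_step[simplified] counts_none[simplified] del: hit_weight.simps)
next
  case (Suc N)
  show ?case
  proof (cases "i = 0")
    case False
    let ?T = "counts_with_steps i (Suc (Suc N))" and ?w = "count_weight i"
    have tup: "counts_with_steps (i - 1) (Suc N) = ?T" using False by (auto simp: counts_with_steps_def)
    have serv: "phase_rate * hit_weight (Suc N) (i - 1)
        = fact N * (\<Sum>m\<in>?T. (real i - 1) * real (i + k * customers m) * ?w m)"
    proof -
      have "phase_rate * hit_weight (Suc N) (i - 1)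
          = fact N * (\<Sum>m\<in>?T. real (i - 1) * (phase_rate * count_weight (i - 1) m))"
        by (simp only: Suc tup sum_distrib_left sum_distrib_right mult_ac)
      also have "\<dots> = fact N * (\<Sum>m\<in>?T. (real i - 1) * real (i + k * customers m) * ?w m)"
        using False unfolding count_weight_service[OF False]
        by (simp only: of_nat_diff mult.assoc) (simp add: of_nat_diff)
      finally show ?thesis .
    qed
    have arr: "lam j * hit_weight (Suc N) (i + k * j)
        = fact N * (\<Sum>m\<in>?T. real (i + k * j) * real (m j) * ?w m)" if j: "j \<in> {1..l}" for j
    proof -
      have "lam j * hit_weight (Suc N) (i + k * j) = fact N * (real (i + k * j) *
          (lam j * (\<Sum>m\<in>counts_with_steps (i + k * j) (Suc N). count_weight (i + k * j) m)))"
        by (simp only: Suc mult_ac)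
      also have "\<dots> = fact N * (\<Sum>m\<in>?T. real (i + k * j) * real (m j) * ?w m)"
        unfolding sum_counts_arrival[OF j] by (simp only: sum_distrib_left mult.assoc)
      finally show ?thesis .
    qed
    have "hit_weight (Suc (Suc N)) i = fact N * ((\<Sum>m\<in>?T. (real i - 1) * real (i + k * customers m) * ?w m)
        + (\<Sum>j=1..l. \<Sum>m\<in>?T. real (i + k * j) * real (m j) * ?w m))"
    proof -
      have "(\<Sum>j=1..l. lam j * hit_weight (Suc N) (i + k * j))
         = (\<Sum>j=1..l. fact N * (\<Sum>m\<in>?T. real (i + k * j) * real (m j) * ?w m))"
        by (intro sum.cong arr) auto
      then show ?thesis
        using False serv by (simp only: hit_weight.simps step_sum_def if_False sum_distrib_left distrib_left)
    qed
    also have "(\<Sum>j=1..l. \<Sum>m\<in>?T. real (i + k * j) * real (m j) * ?w m)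
        = (\<Sum>m\<in>?T. (\<Sum>j=1..l. real (i + k * j) * real (m j)) * ?w m)"
      by (subst sum.swap) (simp only: sum_distrib_right)
    also have "(\<Sum>m\<in>?T. (real i - 1) * real (i + k * customers m) * ?w m) + \<dots>
        = (\<Sum>m\<in>?T. real i * real (Suc N) * ?w m)"
      unfolding sum.distrib[symmetric]
    proof (rule sum.cong)
      fix m assume "m \<in> ?T"
      then have m: "i + groups m + k * customers m = Suc (Suc N)" by (simp add: counts_with_steps_def)
      have "(\<Sum>j=1..l. real (i + k * j) * real (m j)) = real i * real (groups m) + real (k * customers m)"
        by (simp add: groups_def customers_def algebra_simps sum.distrib sum_distrib_left)
      moreover have N: "real (Suc N) = real i + real (groups m) + real (k * customers m) - 1"
        using m by linarith
      ultimately have "(real i - 1) * real (i + k * customers m) + (\<Sum>j=1..l. real (i + k * j) * real (m j))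
          = real i * real (Suc N)"
        unfolding N by (simp add: algebra_simps)
      then show "(real i - 1) * real (i + k * customers m) * ?w m +
          (\<Sum>j=1..l. real (i + k * j) * real (m j)) * ?w m = real i * real (Suc N) * ?w m"
        by (simp only: distrib_right[symmetric])
    qed simp
    finally show ?thesis
      by (simp only: fact_Suc sum_distrib_left mult_ac)
  qed simp
qed

end

text \<open>
  Used twice on the same family, indexed by group counts, to pass from the order of summation given by
  the number of steps to the one given by the number of groups.
\<close>
lemma has_sum_iff_sums_fibres:
  fixes f :: "'a \<Rightarrow> real" and \<nu> :: "'a \<Rightarrow> nat"
  assumes nonneg: "\<And>x. x \<in> X \<Longrightarrow> 0 \<le> f x"
    and finite: "\<And>n. finite {x \<in> X. \<nu> x = n}"
  shows "(f has_sum s) X \<longleftrightarrow> (\<lambda>n. \<Sum>x\<in>{x \<in> X. \<nu> x = n}. f x) sums s"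
proof -
  let ?F = "\<lambda>n. {x \<in> X. \<nu> x = n}"
  have bij: "bij_betw snd (Sigma UNIV ?F) X"
    by (rule bij_betwI[where g = "\<lambda>x. (\<nu> x, x)"]) auto
  have fib: "((\<lambda>x. (\<lambda>z. f (snd z)) (n, x)) has_sum (\<Sum>x\<in>?F n. f x)) (?F n)" for n
    using finite by simp
  have "(f has_sum s) X \<longleftrightarrow> ((\<lambda>z. f (snd z)) has_sum s) (Sigma UNIV ?F)"
    using has_sum_reindex_bij_betw[OF bij] by blast
  also have "\<dots> \<longleftrightarrow> ((\<lambda>n. \<Sum>x\<in>?F n. f x) has_sum s) UNIV"
  proof
    assume "((\<lambda>n. \<Sum>x\<in>?F n. f x) has_sum s) UNIV"
    moreover from this have "(\<lambda>z. f (snd z)) summable_on Sigma UNIV ?F"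
      by (intro summable_on_SigmaI[OF fib]) (auto simp: has_sum_imp_summable nonneg)
    ultimately show "((\<lambda>z. f (snd z)) has_sum s) (Sigma UNIV ?F)"
      using has_sum_SigmaI[OF fib] by blast
  qed (rule has_sum_SigmaD[OF _ fib])
  also have "\<dots> \<longleftrightarrow> (\<lambda>n. \<Sum>x\<in>?F n. f x) sums s"
    by (auto intro: has_sum_imp_sums sums_nonneg_imp_has_sum sum_nonneg nonneg)
  finally show ?thesis .
qed

context erlang_parameters
begin

lemma busy_series_sums:
  assumes c: "\<And>m. m \<in> {1..l} \<Longrightarrow> c m = lam m / arrival_rate" and i: "i \<noteq> 0" and t: "0 \<le> t"
  shows "(\<lambda>n. real i * busy_series_term k l \<mu> arrival_rate c i t n) sums hit_prob i t"
proof -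
  define I where "I N = integral {0..t} (\<lambda>z. z ^ N * exp (- event_rate * z))" for N
  define f where "f m = real i * count_weight i m * I (i + groups m + k * customers m - 1)" for m
  have I_nonneg: "0 \<le> I N" for N
    unfolding I_def by (intro integral_nonneg integrable_continuous_real continuous_intros) auto
  have f_nonneg: "0 \<le> f m" for m
    by (simp add: f_def I_nonneg count_weight_nonneg)
  have fibre: "{m \<in> group_counts. i + groups m + k * customers m - 1 = N} = counts_with_steps i (Suc N)" for N
    using i by (auto simp: counts_with_steps_def)
  have "(\<lambda>N. \<Sum>m\<in>{m \<in> group_counts. i + groups m + k * customers m - 1 = N}. f m) sums hit_prob i t"
  proof -
    have "(\<Sum>m\<in>counts_with_steps i (Suc N). f m) = hit_weight (Suc N) i / fact N * I N" for N
    proof -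
      have "(\<Sum>m\<in>counts_with_steps i (Suc N). f m) = (\<Sum>m\<in>counts_with_steps i (Suc N). real i * count_weight i m * I N)"
        by (intro sum.cong) (auto simp: f_def counts_with_steps_def)
      also have "\<dots> = hit_weight (Suc N) i / fact N * I N"
        unfolding hit_weight_closed_form sum_distrib_right[symmetric] sum_distrib_left[symmetric]
        by simp
      finally show ?thesis .
    qed
    then show ?thesis
      using hit_prob_integral_series[OF i t] unfolding fibre by (simp add: I_def)
  qed
  then have "(f has_sum hit_prob i t) group_counts"
    by (subst has_sum_iff_sums_fibres[where \<nu> = "\<lambda>m. i + groups m + k * customers m - 1"])
      (use fibre finite_counts f_nonneg in auto)
  moreover have "finite {m \<in> group_counts. groups m = n}" for n
    by (rule finite_subset[OF _ finite_groups_le[of n]]) auto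
  ultimately have "(\<lambda>n. \<Sum>m\<in>{m \<in> group_counts. groups m = n}. f m) sums hit_prob i t"
    by (subst (asm) has_sum_iff_sums_fibres[where \<nu> = groups]) (use f_nonneg in auto)
  moreover have "(\<Sum>m\<in>{m \<in> group_counts. groups m = n}. f m)
      = real i * busy_series_term k l \<mu> arrival_rate c i t n" for n
  proof -
    have comp: "compositions l n = {m \<in> group_counts. groups m = n}"
      by (simp add: compositions_def group_counts_def groups_def)
    have w: "arrival_rate ^ n * (\<Prod>j=1..l. c j ^ m j / fact (m j)) = (\<Prod>j=1..l. lam j ^ m j / fact (m j))"
      if "groups m = n" for m
    proof -
      have "(\<Prod>j=1..l. lam j ^ m j / fact (m j)) = (\<Prod>j=1..l. arrival_rate ^ m j * (c j ^ m j / fact (m j)))"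
        using c arrival_rate_pos by (intro prod.cong) (auto simp: power_divide)
      also have "\<dots> = arrival_rate ^ n * (\<Prod>j=1..l. c j ^ m j / fact (m j))"
        unfolding prod.distrib that[symmetric] groups_def power_sum ..
      finally show ?thesis by simp
    qed
    define g where "g m = (\<Prod>j=1..l. c j ^ m j / fact (m j)) *
        ((real k * \<mu>) ^ (i + k * (\<Sum>j=1..l. j * m j)) / fact (i + k * (\<Sum>j=1..l. j * m j))) *
        integral {0..t} (\<lambda>z. z ^ (i + n + k * (\<Sum>j=1..l. j * m j) - 1) * exp (- (arrival_rate + real k * \<mu>) * z))" for m
    have "f m = real i * (arrival_rate ^ n * g m)" if "groups m = n" for m
      unfolding f_def count_weight_def w[OF that, symmetric] I_def that customers_def event_rate_def
        phase_rate_def g_def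
      by (simp only: mult_ac)
    moreover have "busy_series_term k l \<mu> arrival_rate c i t n
        = arrival_rate ^ n * (\<Sum>m\<in>{m \<in> group_counts. groups m = n}. g m)"
      unfolding busy_series_term_def comp g_def ..
    ultimately show ?thesis
      by (simp add: sum_distrib_left)
  qed
  ultimately show ?thesis by simp
qed

end

section \<open>Hitting probabilities along a time grid\<close>

text \<open>
  A Markov chain, seen through the phase count \<open>\<phi>\<close>, that evolves like the walk as long as \<open>\<phi>\<close> is
  positive. At states with \<open>\<phi> x = 0\<close> the rates are arbitrary up to their bound, so that the queue,
  which leaves 0, and the absorbed process, which stays there, are both instances.
\<close>
locale phase_chain = erlang_parameters k l \<mu> lam + bounded_rate_chain S p q r K
  for k l :: nat and \<mu> :: real and lam :: "nat \<Rightarrow> real"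
    and S :: "'s set" and p :: "real \<Rightarrow> 's \<Rightarrow> 's \<Rightarrow> real" and q :: "'s \<Rightarrow> 's \<Rightarrow> real"
    and r :: "'s \<Rightarrow> real" and K :: real +
  fixes \<phi> :: "'s \<Rightarrow> nat"
  assumes bound_eq: "K = event_rate"
    and generator: "\<And>x u. x \<in> S \<Longrightarrow> \<phi> x \<noteq> 0 \<Longrightarrow>
      ((\<lambda>y. q x y * u (\<phi> y)) has_sum step_sum u (\<phi> x)) (S - {x})"
begin

lemma total_rate_eq:
  assumes "x \<in> S" "\<phi> x \<noteq> 0"
  shows "r x = K"
proof -
  have "(q x has_sum event_rate) (S - {x})"
    using generator[OF assms, of "\<lambda>_. 1"] by (simp add: step_sum_const)
  then show ?thesis using has_sum_unique[OF total_rate[OF assms(1)]] by (simp add: bound_eq)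
qed

text \<open>
  The probability, for the chain started from \<open>x\<close> and observed only at multiples of \<open>h\<close>, to be seen in
  a state with phase count 0 within \<open>J\<close> steps.
\<close>
primrec grid_hit :: "real \<Rightarrow> nat \<Rightarrow> 's \<Rightarrow> real" where
  "grid_hit h 0 x = (if \<phi> x = 0 then 1 else 0)"
| "grid_hit h (Suc J) x = (if \<phi> x = 0 then 1 else \<Sum>\<^sub>\<infinity>y\<in>S. p h x y * grid_hit h J y)"

lemma has_sum_weighted:
  assumes "0 \<le> h" "x \<in> S" and "\<And>y. y \<in> S \<Longrightarrow> \<bar>u y\<bar> \<le> C"
  shows "((\<lambda>y. p h x y * u y) has_sum (\<Sum>\<^sub>\<infinity>y\<in>S. p h x y * u y)) S"
  using abs_summable_summable[OF summable_weighted[OF assms]] by simp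

lemma abs_weighted_le:
  assumes "0 \<le> h" "x \<in> S" and u: "\<And>y. y \<in> S \<Longrightarrow> \<bar>u y\<bar> \<le> C"
    and s: "((\<lambda>y. p h x y * u y) has_sum s) S"
  shows "\<bar>s\<bar> \<le> C"
proof (rule abs_leI)
  have C: "((\<lambda>y. p h x y * C) has_sum C) S"
    using has_sum_cmult_left[OF p_row_sum[OF assms(1,2)], of C] by simp
  show "s \<le> C"
    by (rule has_sum_mono[OF s C]) (use u p_nonneg assms in \<open>auto intro!: mult_left_mono simp: abs_le_iff\<close>)
  show "- s \<le> C"
  proof (rule has_sum_mono[OF has_sum_uminusI[OF s] C])
    show "- (p h x y * u y) \<le> p h x y * C" if "y \<in> S" for y
      using u[OF that] p_nonneg[OF assms(1,2) that] mult_left_mono[of "- u y" C "p h x y"] by auto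
  qed
qed

lemma grid_hit_bounds:
  assumes "0 \<le> h" "x \<in> S"
  shows "0 \<le> grid_hit h J x \<and> grid_hit h J x \<le> 1"
  using assms(2)
proof (induction J arbitrary: x)
  case (Suc J)
  have b: "\<bar>grid_hit h J y\<bar> \<le> 1" if "y \<in> S" for y using Suc.IH[OF that] by auto
  have "0 \<le> (\<Sum>\<^sub>\<infinity>y\<in>S. p h x y * grid_hit h J y)"
    using Suc p_nonneg assms(1) by (intro infsum_nonneg mult_nonneg_nonneg) auto
  moreover have "\<bar>\<Sum>\<^sub>\<infinity>y\<in>S. p h x y * grid_hit h J y\<bar> \<le> 1"
    by (rule abs_weighted_le[OF assms(1) Suc.prems b has_sum_weighted[OF assms(1) Suc.prems b]])
  ultimately show ?case by auto
qed simp

lemma grid_hit_has_sum: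
  assumes "0 \<le> h" "x \<in> S" "\<phi> x \<noteq> 0"
  shows "((\<lambda>y. p h x y * grid_hit h J y) has_sum grid_hit h (Suc J) x) S"
  using has_sum_weighted[OF assms(1,2), of "grid_hit h J" 1] grid_hit_bounds[OF assms(1)] assms(3)
  by (simp add: abs_le_iff)

text \<open>
  Each step of the recursion for \<open>grid_hit\<close> averages the previous error and adds
  \<open>2 * K\<^sup>2 * h\<^sup>2\<close> from the transition probabilities and \<open>4 * K\<^sup>2 * h\<^sup>2\<close> from the Taylor
  expansion of \<open>hit_prob\<close>.
\<close>
lemma grid_hit_error:
  assumes h: "0 \<le> h" and "x \<in> S"
  shows "\<bar>grid_hit h J x - hit_prob (\<phi> x) (real J * h)\<bar> \<le> 6 * K\<^sup>2 * h\<^sup>2 * real J"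
  using assms(2)
proof (induction J arbitrary: x)
  case 0
  then show ?case using hit_prob_at_0 hit_prob_time_0 by auto
next
  case (Suc J)
  show ?case
  proof (cases "\<phi> x = 0")
    case False
    define t where "t = real J * h"
    have t: "0 \<le> t" "real (Suc J) * h = t + h" using h by (auto simp: t_def algebra_simps)
    define H where "H y = hit_prob (\<phi> y) t" for y
    have H: "\<bar>H y\<bar> \<le> 1" for y
      using hit_prob_nonneg[OF t(1)] hit_prob_le_1[OF t(1)] by (simp add: H_def)
    have Hs: "((\<lambda>y. p h x y * H y) has_sum (\<Sum>\<^sub>\<infinity>y\<in>S. p h x y * H y)) S"
      by (rule has_sum_weighted[OF h Suc.prems H])
    have "((\<lambda>y. p h x y * (grid_hit h J y - H y)) has_sum
        (grid_hit h (Suc J) x - (\<Sum>\<^sub>\<infinity>y\<in>S. p h x y * H y))) S"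
      using has_sum_minus[OF grid_hit_has_sum[OF h Suc.prems False] Hs] by (simp add: algebra_simps)
    then have "\<bar>grid_hit h (Suc J) x - (\<Sum>\<^sub>\<infinity>y\<in>S. p h x y * H y)\<bar> \<le> 6 * K\<^sup>2 * h\<^sup>2 * real J"
      by (rule abs_weighted_le[OF h Suc.prems, rotated]) (use Suc.IH in \<open>auto simp: H_def t_def\<close>)
    moreover have "\<bar>(\<Sum>\<^sub>\<infinity>y\<in>S. p h x y * H y) - (H x + h * (step_sum (\<lambda>j. hit_prob j t) (\<phi> x) - r x * H x))\<bar>
        \<le> 2 * K\<^sup>2 * h\<^sup>2 * 1"
      by (rule generator_approximation[OF h Suc.prems H])
        (use generator[OF Suc.prems False, of "\<lambda>j. hit_prob j t"] in \<open>simp add: H_def\<close>)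
    moreover have "\<bar>hit_prob (\<phi> x) (t + h) - (H x + h * (step_sum (\<lambda>j. hit_prob j t) (\<phi> x) - r x * H x))\<bar>
        \<le> 4 * K\<^sup>2 * h\<^sup>2"
      using hit_prob_taylor[OF t(1) h False] total_rate_eq[OF Suc.prems False]
      by (simp add: H_def bound_eq)
    moreover have "6 * K\<^sup>2 * h\<^sup>2 * real (Suc J) = 6 * K\<^sup>2 * h\<^sup>2 * real J + 6 * K\<^sup>2 * h\<^sup>2"
      by (simp add: algebra_simps)
    ultimately show ?thesis unfolding t(2) by linarith
  qed (simp add: hit_prob_at_0)
qed

lemma isCont_hit_prob: "isCont (hit_prob i) t"
proof (cases "i = 0")
  case True
  then have "hit_prob i = (\<lambda>_. 1)" using hit_prob_at_0 by auto
  then show ?thesis by simp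
qed (use hit_prob_derivative DERIV_isCont in blast)

lemma grid_hit_limit:
  assumes h: "\<And>n. 0 \<le> h n" "h \<longlonglongrightarrow> 0" and J: "(\<lambda>n. real (J n) * h n) \<longlonglongrightarrow> t" and x: "x \<in> S"
  shows "(\<lambda>n. grid_hit (h n) (J n) x) \<longlonglongrightarrow> hit_prob (\<phi> x) t"
proof -
  have H: "(\<lambda>n. hit_prob (\<phi> x) (real (J n) * h n)) \<longlonglongrightarrow> hit_prob (\<phi> x) t"
    by (rule isCont_tendsto_compose[OF isCont_hit_prob J])
  have "(\<lambda>n. grid_hit (h n) (J n) x - hit_prob (\<phi> x) (real (J n) * h n)) \<longlonglongrightarrow> 0"
  proof (rule Lim_null_comparison)
    have "(\<lambda>n. 6 * K\<^sup>2 * h n * (real (J n) * h n)) \<longlonglongrightarrow> 6 * K\<^sup>2 * 0 * t"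
      by (intro tendsto_intros h J)
    then show "(\<lambda>n. 6 * K\<^sup>2 * h n * (real (J n) * h n)) \<longlonglongrightarrow> 0" by simp
    show "\<forall>\<^sub>F n in sequentially. norm (grid_hit (h n) (J n) x - hit_prob (\<phi> x) (real (J n) * h n))
        \<le> 6 * K\<^sup>2 * h n * (real (J n) * h n)"
    proof (rule always_eventually, rule allI)
      fix n
      have "6 * K\<^sup>2 * h n * (real (J n) * h n) = 6 * K\<^sup>2 * (h n)\<^sup>2 * real (J n)"
        by (simp add: power2_eq_square)
      then show "norm (grid_hit (h n) (J n) x - hit_prob (\<phi> x) (real (J n) * h n))
          \<le> 6 * K\<^sup>2 * h n * (real (J n) * h n)"
        using grid_hit_error[OF h(1)[of n] x, of "J n"] by (simp only: real_norm_def)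
    qed
  qed
  from tendsto_add[OF this H] show ?thesis by simp
qed

text \<open>
  If the only state with phase count 0 has exit rate 0, it is never left, and being there at the last
  grid time is the same as having been seen there at some grid time.
\<close>
lemma absorbed_prob_eq_grid_hit:
  assumes h: "0 \<le> h" and z: "z \<in> S" "r z = 0" "\<And>x. x \<in> S \<Longrightarrow> \<phi> x = 0 \<longleftrightarrow> x = z" and x: "x \<in> S"
  shows "p (real n * h) x z = grid_hit h n x"
  using x
proof (induction n arbitrary: x)
  case 0
  then show ?case using p_zero z by simp
next
  case (Suc n)
  have nonneg: "0 \<le> real n * h" "0 \<le> real (Suc n) * h" using h by auto
  have zz: "p t z z = 1" if "0 \<le> t" for t
    using stay_prob_lower[OF that z(1)] p_le_1[OF that z(1) z(1)] z(2) by simp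
  show ?case
  proof (cases "x = z")
    case True
    then show ?thesis using z zz[OF nonneg(2)] by simp
  next
    case False
    have "((\<lambda>y. p h x y * p (real n * h) y z) has_sum p (h + real n * h) x z) S"
      by (rule chapman_kolmogorov[OF h nonneg(1) Suc.prems z(1)])
    moreover have "((\<lambda>y. p h x y * p (real n * h) y z) has_sum grid_hit h (Suc n) x) S"
      using grid_hit_has_sum[OF h Suc.prems, of n] False z(3)[OF Suc.prems] Suc.IH
      by (subst has_sum_cong[where g = "\<lambda>y. p h x y * grid_hit h n y"]) auto
    ultimately have "p (h + real n * h) x z = grid_hit h (Suc n) x" by (rule has_sum_unique)
    then show ?thesis by (simp add: algebra_simps)
  qed
qed

text \<open>
  The left-hand side equals \<open>grid_hit\<close> for the grid of mesh \<open>t / n\<close> for every \<open>n\<close>, so it equals the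
  limit.
\<close>
lemma absorbed_prob:
  assumes t: "0 \<le> t" and z: "z \<in> S" "r z = 0" "\<And>x. x \<in> S \<Longrightarrow> \<phi> x = 0 \<longleftrightarrow> x = z" and x: "x \<in> S"
  shows "p t x z = hit_prob (\<phi> x) t"
proof -
  have eq: "real (Suc n) * (t / real (Suc n)) = t" for n by simp
  have "(\<lambda>n. grid_hit (t / real (Suc n)) (Suc n) x) \<longlonglongrightarrow> hit_prob (\<phi> x) t"
    by (rule grid_hit_limit[OF _ _ _ x])
      (use t LIMSEQ_Suc[OF lim_const_over_n[of t]] in \<open>simp_all only: eq, auto\<close>)
  moreover have "grid_hit (t / real (Suc n)) (Suc n) x = p t x z" for n
    using absorbed_prob_eq_grid_hit[OF _ z x, of "t / real (Suc n)" "Suc n"] t unfolding eq by simp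
  ultimately show ?thesis by (simp add: LIMSEQ_const_iff)
qed

end

section \<open>The generator of the queue in phases\<close>

lemma has_sum_point_masses:
  fixes w :: "'i \<Rightarrow> real"
  assumes "finite I" "\<And>i. i \<in> I \<Longrightarrow> b i \<in> A"
  shows "((\<lambda>y. (\<Sum>i\<in>I. if y = b i then w i else 0) * v y) has_sum (\<Sum>i\<in>I. w i * v (b i))) A"
  using assms
proof (induction I rule: finite_induct)
  case (insert i I)
  have "((\<lambda>y. (if y = b i then w i else 0) * v y) has_sum w i * v (b i)) A"
    by (rule has_sum_finite_neutralI[of "{b i}"]) (use insert in auto)
  from has_sum_add[OF this insert.IH] insert show ?case by (simp add: distrib_right)
qed simp

context erlang_parameters
begin

definition after_phase_completion :: "nat \<times> nat \<Rightarrow> nat \<times> nat" where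
  "after_phase_completion = (\<lambda>(n, s). if s \<ge> 2 then (n, s - 1) else if n \<ge> 2 then (n - 1, k) else (0, 0))"

lemma erlang_rate_busy:
  assumes "(n, s) \<in> erlang_states k" "n \<noteq> 0"
  shows "erlang_rate k l \<mu> lam (n, s) y =
    (\<Sum>m=1..l. if y = (n + m, s) then lam m else 0) + (if y = after_phase_completion (n, s) then phase_rate else 0)"
  using assms by (auto simp: erlang_rate_def after_phase_completion_def erlang_states_def phase_rate_def)

lemma erlang_rate_idle:
  "erlang_rate k l \<mu> lam (0, 0) y = (\<Sum>m=1..l. if y = (m, k) then lam m else 0)"
  by (simp add: erlang_rate_def)

lemma after_phase_completion_state:
  assumes "(n, s) \<in> erlang_states k" "n \<noteq> 0"
  shows "after_phase_completion (n, s) \<in> erlang_states k - {(n, s)}" "phases k (after_phase_completion (n, s)) = phases k (n, s) - 1"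
proof -
  show "after_phase_completion (n, s) \<in> erlang_states k - {(n, s)}"
    using assms k_pos by (auto simp: after_phase_completion_def erlang_states_def)
  show "phases k (after_phase_completion (n, s)) = phases k (n, s) - 1"
  proof (cases "s \<ge> 2")
    case False
    then have s: "s = 1" using assms by (auto simp: erlang_states_def)
    show ?thesis
    proof (cases "n \<ge> 2")
      case True
      then obtain n' where "n = Suc (Suc n')" by (metis Suc_1 Suc_le_D add_2_eq_Suc' le_Suc_ex add.commute)
      then show ?thesis using s by (simp add: after_phase_completion_def phases_def)
    qed (use s assms in \<open>auto simp: after_phase_completion_def phases_def\<close>)
  qed (use assms in \<open>auto simp: after_phase_completion_def phases_def\<close>)
qed

lemma phases_eq_0_iff: "x \<in> erlang_states k \<Longrightarrow> phases k x = 0 \<longleftrightarrow> x = (0, 0)"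
  by (auto simp: phases_def erlang_states_def)

text \<open>
  On functions of the phase count the generator of the queue is that of the walk: an arriving group of
  \<open>m\<close> customers adds \<open>k * m\<close> phases, and the completion of a phase removes one in each of its three
  cases.
\<close>
lemma erlang_generator:
  assumes x: "x \<in> erlang_states k" "phases k x \<noteq> 0"
  shows "((\<lambda>y. erlang_rate k l \<mu> lam x y * u (phases k y)) has_sum step_sum u (phases k x))
    (erlang_states k - {x})"
proof -
  obtain n s where xs: "x = (n, s)" by (cases x)
  have n: "n \<noteq> 0" "(n, s) \<in> erlang_states k" using x by (auto simp: xs phases_def split: if_splits)
  have up: "(n + m, s) \<in> erlang_states k - {x}" "phases k (n + m, s) = phases k x + k * m" if "m \<in> {1..l}" for m
  proof -
    show "(n + m, s) \<in> erlang_states k - {x}" using n that by (auto simp: xs erlang_states_def)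
    obtain n' where "n = Suc n'" using n by (cases n) auto
    then show "phases k (n + m, s) = phases k x + k * m" by (simp add: xs phases_def algebra_simps)
  qed
  have "((\<lambda>y. (\<Sum>m\<in>{1..l}. if y = (n + m, s) then lam m else 0) * u (phases k y))
      has_sum (\<Sum>m\<in>{1..l}. lam m * u (phases k (n + m, s)))) (erlang_states k - {x})"
    by (rule has_sum_point_masses) (use up in auto)
  moreover have "((\<lambda>y. (\<Sum>i\<in>{()}. if y = after_phase_completion x then phase_rate else 0) * u (phases k y))
      has_sum (\<Sum>i\<in>{()}. phase_rate * u (phases k (after_phase_completion x)))) (erlang_states k - {x})"
    by (rule has_sum_point_masses) (use after_phase_completion_state(1)[OF n(2,1)] xs in auto)
  ultimately have "((\<lambda>y. (\<Sum>m\<in>{1..l}. if y = (n + m, s) then lam m else 0) * u (phases k y) +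
        (\<Sum>i\<in>{()}. if y = after_phase_completion x then phase_rate else 0) * u (phases k y))
      has_sum ((\<Sum>m\<in>{1..l}. lam m * u (phases k (n + m, s))) +
        (\<Sum>i\<in>{()}. phase_rate * u (phases k (after_phase_completion x))))) (erlang_states k - {x})"
    by (rule has_sum_add)
  moreover have "(\<Sum>m\<in>{1..l}. lam m * u (phases k (n + m, s))) = (\<Sum>m\<in>{1..l}. lam m * u (phases k x + k * m))"
    using up(2) by (intro sum.cong) auto
  ultimately show ?thesis
    using erlang_rate_busy[OF n(2,1)] after_phase_completion_state(2)[OF n(2,1)]
    by (simp add: xs step_sum_def distrib_right add.commute)
qed

lemma erlang_idle_rate:
  "(erlang_rate k l \<mu> lam (0, 0) has_sum arrival_rate) (erlang_states k - {(0, 0)})"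
proof -
  have "((\<lambda>y. (\<Sum>m\<in>{1..l}. if y = (m, k) then lam m else 0) * 1) has_sum (\<Sum>m\<in>{1..l}. lam m * 1))
      (erlang_states k - {(0, 0)})"
    by (rule has_sum_point_masses) (use k_pos in \<open>auto simp: erlang_states_def\<close>)
  then show ?thesis by (simp add: erlang_rate_idle[abs_def] arrival_rate_def)
qed

lemma erlang_rate_nonneg: "0 \<le> erlang_rate k l \<mu> lam x y"
proof (cases x)
  case (Pair n s)
  have "0 \<le> (\<Sum>m=1..l. if (n = 0 \<and> y = (m, k)) \<or> (n \<ge> 1 \<and> y = (n + m, s)) then lam m else 0)"
    using lam_pos by (intro sum_nonneg) (auto simp: less_imp_le)
  then show ?thesis using Pair mu_pos by (auto simp: erlang_rate_def intro!: add_nonneg_nonneg)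
qed

lemma erlang_phase_chain:
  assumes "transition_function (erlang_states k) p"
    and "has_transition_rates (erlang_states k) p (erlang_rate k l \<mu> lam)"
  shows "phase_chain k l \<mu> lam (erlang_states k) p (erlang_rate k l \<mu> lam)
    (\<lambda>x. if x = (0, 0) then arrival_rate else event_rate) event_rate (phases k)"
proof unfold_locales
  fix x assume x: "x \<in> erlang_states k"
  show "(erlang_rate k l \<mu> lam x has_sum (if x = (0, 0) then arrival_rate else event_rate)) (erlang_states k - {x})"
  proof (cases "x = (0, 0)")
    case False
    then show ?thesis using erlang_generator[OF x, of "\<lambda>_. 1"] phases_eq_0_iff[OF x]
      by (simp add: step_sum_const)
  qed (simp add: erlang_idle_rate)
  show "(if x = (0, 0) then arrival_rate else event_rate) \<le> event_rate"
    using phase_rate_pos by (auto simp: event_rate_def)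
next
  fix x u assume "x \<in> erlang_states k" "phases k x \<noteq> 0"
  then show "((\<lambda>y. erlang_rate k l \<mu> lam x y * u (phases k y)) has_sum step_sum u (phases k x))
    (erlang_states k - {x})" by (rule erlang_generator)
qed (use assms erlang_rate_nonneg in auto)

lemma absorbed_generator:
  assumes "i \<noteq> 0"
  shows "((\<lambda>j. absorbed_phase_rate k l \<mu> lam i j * u j) has_sum step_sum u i) (UNIV - {i})"
proof -
  define g where "g = inv_into (erlang_states k) (phases k)"
  have bij: "bij_betw g UNIV (erlang_states k)"
    unfolding g_def using bij_betw_inv_into[OF bij_betw_phases[OF k_pos]] .
  have \<phi>g: "phases k (g j) = j" for j
    unfolding g_def using bij_betw_inv_into_right[OF bij_betw_phases[OF k_pos]] by simp
  have gi: "g i \<in> erlang_states k" using bij by (auto simp: bij_betw_def)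
  have "bij_betw g (UNIV - {i}) (erlang_states k - {g i})"
    using bij by (auto simp: bij_betw_def inj_on_def)
  from has_sum_reindex_bij_betw[OF this, of "\<lambda>y. erlang_rate k l \<mu> lam (g i) y * u (phases k y)"]
  show ?thesis
    using erlang_generator[OF gi, of u] assms
    by (simp add: \<phi>g absorbed_phase_rate_def flip: g_def)
qed

lemma absorbed_phase_chain:
  assumes "transition_function UNIV p"
    and "has_transition_rates UNIV p (absorbed_phase_rate k l \<mu> lam)"
  shows "phase_chain k l \<mu> lam UNIV p (absorbed_phase_rate k l \<mu> lam)
    (\<lambda>i. if i = 0 then 0 else event_rate) event_rate (\<lambda>i. i)"
proof unfold_locales
  fix i :: nat
  show "(absorbed_phase_rate k l \<mu> lam i has_sum (if i = 0 then 0 else event_rate)) (UNIV - {i})"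
  proof (cases "i = 0")
    case True
    then have "absorbed_phase_rate k l \<mu> lam i = (\<lambda>_. 0)"
      by (simp add: absorbed_phase_rate_def fun_eq_iff)
    then show ?thesis using True by simp
  next
    case False
    then show ?thesis using absorbed_generator[of i "\<lambda>_. 1"] by (simp add: step_sum_const)
  qed
next
  fix i :: nat and u assume "i \<noteq> 0"
  then show "((\<lambda>y. absorbed_phase_rate k l \<mu> lam i y * u y) has_sum step_sum u i) (UNIV - {i})"
    by (rule absorbed_generator)
qed (use assms erlang_rate_nonneg event_rate_pos in \<open>auto simp: absorbed_phase_rate_def\<close>)

lemma absorbed_process_prob:
  assumes L: "absorbed_phase_process M L k l \<mu> lam a" and a: "a \<noteq> 0" and t: "0 \<le> t"
  shows "\<P>(\<omega> in M. L t \<omega> = 0 \<bar> L 0 \<omega> = a) = hit_prob a t"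
proof -
  have mp: "markov_process M L UNIV (absorbed_phase_rate k l \<mu> lam)" and L0: "AE \<omega> in M. L 0 \<omega> = a"
    using L by (auto simp: absorbed_phase_process_def)
  then interpret prob_space M by (simp add: markov_process_def)
  have meas [measurable]: "L t \<in> measurable M (count_space UNIV)" if "0 \<le> t" for t
    using mp that by (auto simp: markov_process_def)
  have [measurable]: "L 0 \<in> measurable M (count_space UNIV)" by (rule meas) simp
  obtain p where p: "transition_function UNIV p" "has_transition_rates UNIV p (absorbed_phase_rate k l \<mu> lam)"
    and fdd: "\<And>(n::nat) (\<tau>::nat \<Rightarrow> real) (x::nat \<Rightarrow> nat). 0 \<le> \<tau> 0 \<Longrightarrow> (\<forall>i\<le>n. \<tau> i < \<tau> (Suc i)) \<Longrightarrow>
       \<P>(\<omega> in M. \<forall>i\<le>Suc n. L (\<tau> i) \<omega> = x i) =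
       \<P>(\<omega> in M. \<forall>i\<le>n. L (\<tau> i) \<omega> = x i) * p (\<tau> (Suc n) - \<tau> n) (x n) (x (Suc n))"
    using mp unfolding markov_process_def by auto
  interpret phase_chain k l \<mu> lam UNIV p "absorbed_phase_rate k l \<mu> lam"
    "\<lambda>i. if i = 0 then 0 else event_rate" event_rate "\<lambda>i. i"
    by (rule absorbed_phase_chain[OF p])
  have P0: "prob {\<omega> \<in> space M. L 0 \<omega> = a} = 1"
    using L0 by (subst prob_Collect_eq_1) auto
  have "\<P>(\<omega> in M. L t \<omega> = 0 \<and> L 0 \<omega> = a) = hit_prob a t"
  proof (cases "t = 0")
    case True
    have "{\<omega> \<in> space M. L 0 \<omega> = 0 \<and> L 0 \<omega> = a} = {}" using a by auto
    then have "prob {\<omega> \<in> space M. L 0 \<omega> = 0 \<and> L 0 \<omega> = a} = 0" by (simp only: measure_empty)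
    then show ?thesis using True a hit_prob_time_0 by simp
  next
    case False
    then have t0: "0 < t" using t by simp
    have eq: "(\<forall>i\<le>Suc 0. L (if i = 0 then 0 else t) \<omega> = (if i = 0 then a else 0)) \<longleftrightarrow> L t \<omega> = 0 \<and> L 0 \<omega> = a" for \<omega>
      by (auto simp: le_Suc_eq)
    show ?thesis
      using fdd[of "\<lambda>i. if i = 0 then 0 else t" 0 "\<lambda>i. if i = 0 then a else 0"] t0 P0
        absorbed_prob[OF t, of 0 a]
      unfolding eq by simp
  qed
  then show ?thesis using P0 by (simp add: cond_prob_def)
qed

end

section \<open>Entrance times of right-continuous paths\<close>

text \<open>
  For a right-continuous path with discrete values, the infimum of the times spent in a set is
  attained: the path is constant on some interval to the right of the infimum, and this interval
  contains times at which the path is in the set.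
\<close>
lemma entrance_time:
  fixes x :: "real \<Rightarrow> 's" and s :: real
  assumes rc: "\<And>t. t \<ge> 0 \<Longrightarrow> \<forall>\<^sub>F u in at_right t. x u = x t" and s: "0 \<le> s"
    and ne: "\<exists>t\<ge>s. A (x t)"
  obtains T where "s \<le> T" "A (x T)" "\<And>t. s \<le> t \<Longrightarrow> t < T \<Longrightarrow> \<not> A (x t)"
    "(INF t\<in>{t. s \<le> t \<and> A (x t)}. ereal t) = ereal T"
proof -
  define B where "B = {t. s \<le> t \<and> A (x t)}"
  define T where "T = Inf B"
  have B: "B \<noteq> {}" "bdd_below B" using ne by (auto simp: B_def bdd_below_def)
  have T_le: "T \<le> t" if "t \<in> B" for t using that B by (auto simp: T_def intro: cInf_lower)
  have sT: "s \<le> T" unfolding T_def using B by (intro cInf_greatest) (auto simp: B_def)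
  have "\<forall>\<^sub>F u in at_right T. x u = x T" using rc sT s by simp
  then obtain b where b: "b > T" "\<And>u. T < u \<Longrightarrow> u < b \<Longrightarrow> x u = x T"
    unfolding eventually_at_right_field by blast
  obtain u where u: "u \<in> B" "u < b" using cInf_lessD[OF B(1)] b(1) by (auto simp: T_def)
  have AT: "A (x T)"
  proof (cases "u = T")
    case False
    then have "x u = x T" using T_le[OF u(1)] u(2) by (intro b(2)) auto
    then show ?thesis using u(1) by (simp add: B_def)
  qed (use u in \<open>simp add: B_def\<close>)
  show thesis
  proof (rule that[OF sT AT])
    show "\<not> A (x t)" if "s \<le> t" "t < T" for t using T_le[of t] that by (auto simp: B_def)
    show "(INF t\<in>{t. s \<le> t \<and> A (x t)}. ereal t) = ereal T"
    proof (rule antisym)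
      show "(INF t\<in>{t. s \<le> t \<and> A (x t)}. ereal t) \<le> ereal T"
        by (rule INF_lower) (use sT AT in simp)
      show "ereal T \<le> (INF t\<in>{t. s \<le> t \<and> A (x t)}. ereal t)"
        by (rule INF_greatest) (use T_le in \<open>simp add: B_def\<close>)
    qed
  qed
qed

definition mesh :: "nat \<Rightarrow> real" where
  "mesh n = 1 / real (Suc n)"

lemma mesh_pos: "0 < mesh n"
  by (simp add: mesh_def)

lemma mesh_tendsto: "mesh \<longlonglongrightarrow> 0"
  unfolding mesh_def using LIMSEQ_inverse_real_of_nat by (simp add: inverse_eq_divide)

lemma mesh_eventually_less: "0 < e \<Longrightarrow> \<forall>\<^sub>F n in sequentially. mesh n < e"
  using mesh_tendsto by (rule order_tendstoD)

text \<open>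
  The first grid point at or after time \<open>t\<close>; rounding up places it on the side on which
  right-continuous paths are constant.
\<close>
definition grid_index :: "nat \<Rightarrow> real \<Rightarrow> nat" where
  "grid_index n t = nat \<lceil>t / mesh n\<rceil>"

lemma grid_index_bounds:
  assumes "0 \<le> t"
  shows "t \<le> real (grid_index n t) * mesh n" "real (grid_index n t) * mesh n < t + mesh n"
proof -
  have pos: "0 \<le> t / mesh n" using assms mesh_pos[of n] by simp
  have "real (grid_index n t) = of_int \<lceil>t / mesh n\<rceil>"
    using pos by (simp add: grid_index_def)
  then have "t / mesh n \<le> real (grid_index n t)" "real (grid_index n t) < t / mesh n + 1"
    by linarith+
  then show "t \<le> real (grid_index n t) * mesh n" "real (grid_index n t) * mesh n < t + mesh n"
    using mesh_pos[of n] by (simp_all add: field_simps)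
qed

lemma grid_index_less:
  assumes "0 \<le> t" "j < grid_index n t"
  shows "real j * mesh n < t"
proof -
  have "real (Suc j) * mesh n \<le> real (grid_index n t) * mesh n"
    using assms(2) mesh_pos[of n] by (intro mult_right_mono) auto
  then show ?thesis using grid_index_bounds(2)[OF assms(1), of n] by (simp add: distrib_right)
qed

lemma grid_index_tendsto:
  assumes "0 \<le> t"
  shows "(\<lambda>n. real (grid_index n t) * mesh n) \<longlonglongrightarrow> t"
proof (rule tendsto_sandwich[OF _ _ tendsto_const])
  show "(\<lambda>n. t + mesh n) \<longlonglongrightarrow> t" using tendsto_add[OF tendsto_const mesh_tendsto, of t] by simp
qed (use grid_index_bounds[OF assms] in \<open>auto intro!: always_eventually simp: less_imp_le\<close>)

lemma grid_catches_value:
  fixes x :: "real \<Rightarrow> 's"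
  assumes rc: "\<forall>\<^sub>F u in at_right T. x u = x T" and T: "0 \<le> T"
  shows "\<forall>\<^sub>F n in sequentially. x (real (grid_index n T) * mesh n) = x T"
proof -
  obtain b where b: "b > T" "\<And>u. T < u \<Longrightarrow> u < b \<Longrightarrow> x u = x T"
    using rc unfolding eventually_at_right_field by blast
  have "\<forall>\<^sub>F n in sequentially. mesh n < b - T" using b by (intro mesh_eventually_less) simp
  then show ?thesis
  proof eventually_elim
    case (elim n)
    show ?case
      using grid_index_bounds[OF T, of n] elim b(2)[of "real (grid_index n T) * mesh n"]
      by (cases "real (grid_index n T) * mesh n = T") auto
  qed
qed

definition grid_start :: "(real \<Rightarrow> 'w \<Rightarrow> nat \<times> nat) \<Rightarrow> real \<Rightarrow> nat \<Rightarrow> nat \<Rightarrow> 'w \<Rightarrow> bool" where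
  "grid_start Q h m i \<omega> \<longleftrightarrow> (\<forall>j<i. fst (Q (real j * h) \<omega>) = 0) \<and> fst (Q (real i * h) \<omega>) = m"

definition grid_return :: "(real \<Rightarrow> 'w \<Rightarrow> nat \<times> nat) \<Rightarrow> real \<Rightarrow> nat \<Rightarrow> nat \<Rightarrow> 'w \<Rightarrow> bool" where
  "grid_return Q h J i \<omega> \<longleftrightarrow> (\<exists>r\<le>J. fst (Q (real (i + r) * h) \<omega>) = 0)"

lemma grid_start_unique:
  assumes "m \<noteq> 0" "m' \<noteq> 0" "grid_start Q h m i \<omega>" "grid_start Q h m' i' \<omega>"
  shows "i = i'"
  using assms unfolding grid_start_def by (metis nat_neq_iff)

text \<open>
  Let \<open>T\<close> be the start and \<open>D\<close> the end of the busy period. For fine grids the first grid point after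
  \<open>T\<close> still shows the initial group, and the first grid point after \<open>D\<close> shows an empty system. A busy
  period of length at most \<open>t\<close> then takes at most \<open>grid_index n t\<close> grid steps, even in the boundary
  case \<open>D - T = t\<close>; a longer one exceeds \<open>t\<close> by more than two meshes once the grid is fine enough, and
  is then recognized as longer. So there is no exceptional value of \<open>t\<close>.
\<close>
lemma busy_period_on_grid:
  assumes rc: "\<And>t. t \<ge> 0 \<Longrightarrow> \<forall>\<^sub>F u in at_right t. Q u \<omega> = Q t \<omega>" and m: "m \<noteq> 0" and t: "0 \<le> t"
  shows "\<forall>\<^sub>F n in sequentially. (\<exists>i. grid_start Q (mesh n) m i \<omega>) \<longleftrightarrow> initial_group Q \<omega> = m"
    and "\<forall>\<^sub>F n in sequentially.
      (\<exists>i. grid_start Q (mesh n) m i \<omega> \<and> grid_return Q (mesh n) (grid_index n t) i \<omega>)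
        \<longleftrightarrow> initial_group Q \<omega> = m \<and> busy_duration Q \<omega> \<le> ereal t"
proof -
  let ?start = "\<forall>\<^sub>F n in sequentially. (\<exists>i. grid_start Q (mesh n) m i \<omega>) \<longleftrightarrow> initial_group Q \<omega> = m"
  let ?return = "\<forall>\<^sub>F n in sequentially.
      (\<exists>i. grid_start Q (mesh n) m i \<omega> \<and> grid_return Q (mesh n) (grid_index n t) i \<omega>)
        \<longleftrightarrow> initial_group Q \<omega> = m \<and> busy_duration Q \<omega> \<le> ereal t"
  have "?start \<and> ?return"
  proof (cases "\<exists>t\<ge>0. fst (Q t \<omega>) > 0")
    case False
    then have never: "{t. 0 \<le> t \<and> fst (Q t \<omega>) > 0} = {}" by auto
    have "busy_start Q \<omega> = \<infinity>" unfolding busy_start_def never by (simp add: top_ereal_def)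
    then have "initial_group Q \<omega> \<noteq> m" using m by (simp add: initial_group_def)
    moreover have "\<not> grid_start Q (mesh n) m i \<omega>" for n i
    proof
      assume "grid_start Q (mesh n) m i \<omega>"
      then have "fst (Q (real i * mesh n) \<omega>) > 0" using m by (simp add: grid_start_def)
      moreover have "0 \<le> real i * mesh n" using mesh_pos[of n] by simp
      ultimately show False using False by blast
    qed
    ultimately show ?thesis by simp
  next
    case True
    obtain T where T: "0 \<le> T" "fst (Q T \<omega>) > 0" "\<And>u. 0 \<le> u \<Longrightarrow> u < T \<Longrightarrow> \<not> fst (Q u \<omega>) > 0"
      "busy_start Q \<omega> = ereal T"
      using entrance_time[of "\<lambda>t. Q t \<omega>" 0 "\<lambda>y. fst y > 0"] rc True unfolding busy_start_def by blast
    define g where "g = fst (Q T \<omega>)"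
    have group: "initial_group Q \<omega> = g" using T(4) by (simp add: initial_group_def g_def)
    have g0: "g \<noteq> 0" using T(2) by (simp add: g_def)
    define s where "s n = grid_index n T" for n
    have first: "\<forall>\<^sub>F n in sequentially. grid_start Q (mesh n) g (s n) \<omega>"
      using grid_catches_value[of "\<lambda>t. Q t \<omega>" T, OF rc[OF T(1)] T(1)]
    proof eventually_elim
      case (elim n)
      have "fst (Q (real j * mesh n) \<omega>) = 0" if "j < s n" for j
        using T(3)[of "real j * mesh n"] grid_index_less[OF T(1), of j n] that mesh_pos[of n]
        by (simp add: s_def)
      then show ?case using elim by (simp add: grid_start_def s_def g_def)
    qed
    then have start: "\<forall>\<^sub>F n in sequentially. \<forall>i. grid_start Q (mesh n) m i \<omega> \<longleftrightarrow> g = m \<and> i = s n"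
    proof eventually_elim
      case (elim n)
      show ?case
      proof (intro allI iffI)
        fix i assume i: "grid_start Q (mesh n) m i \<omega>"
        have "i = s n" by (rule grid_start_unique[OF m g0 i elim])
        then show "g = m \<and> i = s n" using i elim by (simp add: grid_start_def)
      qed (use elim in auto)
    qed
    have ?start using start by eventually_elim (use group in auto)
    moreover have ?return
    proof -
      have dur: "busy_duration Q \<omega> = (INF u\<in>{u. T \<le> u \<and> fst (Q u \<omega>) = 0}. ereal u) - ereal T"
        by (simp add: busy_duration_def T(4))
      have ret: "\<forall>\<^sub>F n in sequentially. grid_return Q (mesh n) (grid_index n t) (s n) \<omega>
          \<longleftrightarrow> busy_duration Q \<omega> \<le> ereal t"
      proof (cases "\<exists>u\<ge>T. fst (Q u \<omega>) = 0")
        case False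
        then have never: "{u. T \<le> u \<and> fst (Q u \<omega>) = 0} = {}" by auto
        have "busy_duration Q \<omega> = \<infinity>" unfolding dur never by (simp add: top_ereal_def)
        moreover have "\<not> grid_return Q (mesh n) (grid_index n t) (s n) \<omega>" for n
        proof
          assume "grid_return Q (mesh n) (grid_index n t) (s n) \<omega>"
          then obtain r where r: "fst (Q (real (s n + r) * mesh n) \<omega>) = 0" by (auto simp: grid_return_def)
          have "T \<le> real (s n) * mesh n" using grid_index_bounds(1)[OF T(1)] by (simp add: s_def)
          also have "\<dots> \<le> real (s n + r) * mesh n" using mesh_pos[of n] by (intro mult_right_mono) auto
          finally show False using False r by blast
        qed
        ultimately show ?thesis by simp
      next
        case True
        obtain D where D: "T \<le> D" "fst (Q D \<omega>) = 0" "\<And>u. T \<le> u \<Longrightarrow> u < D \<Longrightarrow> fst (Q u \<omega>) \<noteq> 0"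
          "(INF u\<in>{u. T \<le> u \<and> fst (Q u \<omega>) = 0}. ereal u) = ereal D"
          using entrance_time[of "\<lambda>t. Q t \<omega>" T "\<lambda>y. fst y = 0"] rc True T(1) by blast
        have D0: "0 \<le> D" using D(1) T(1) by simp
        have dD: "busy_duration Q \<omega> = ereal (D - T)" by (simp add: dur D(4))
        show ?thesis
        proof (cases "D - T \<le> t")
          case True
          have "\<forall>\<^sub>F n in sequentially. grid_return Q (mesh n) (grid_index n t) (s n) \<omega>"
            using grid_catches_value[of "\<lambda>t. Q t \<omega>" D, OF rc[OF D0] D0]
          proof eventually_elim
            case (elim n)
            define d where "d = grid_index n D"
            have le: "s n \<le> d" unfolding s_def d_def grid_index_def
              using D(1) mesh_pos[of n] by (intro nat_mono ceiling_mono divide_right_mono) auto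
            have "real (d - s n) * mesh n < (t / mesh n + 1) * mesh n"
              using grid_index_bounds(1)[OF T(1), of n] grid_index_bounds(2)[OF D0, of n] True le mesh_pos[of n]
              by (simp add: s_def d_def left_diff_distrib distrib_right)
            then have "real (d - s n) < t / mesh n + 1" using mesh_pos[of n] by simp
            then have "d - s n \<le> grid_index n t" unfolding grid_index_def by linarith
            moreover have "fst (Q (real (s n + (d - s n)) * mesh n) \<omega>) = 0"
              using le elim D(2) by (simp add: d_def)
            ultimately show ?case by (auto simp: grid_return_def)
          qed
          then show ?thesis by eventually_elim (use True dD in simp)
        next
          case False
          \<comment> \<open>The starting point and the number of steps are each rounded up by less than one mesh.\<close>
          have "\<forall>\<^sub>F n in sequentially. mesh n < (D - T - t) / 2" using False by (intro mesh_eventually_less) simp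
          then have "\<forall>\<^sub>F n in sequentially. \<not> grid_return Q (mesh n) (grid_index n t) (s n) \<omega>"
          proof eventually_elim
            case (elim n)
            show ?case
            proof
              assume "grid_return Q (mesh n) (grid_index n t) (s n) \<omega>"
              then obtain r where r: "r \<le> grid_index n t" "fst (Q (real (s n + r) * mesh n) \<omega>) = 0"
                by (auto simp: grid_return_def)
              have rm: "0 \<le> real r * mesh n" "real r * mesh n \<le> real (grid_index n t) * mesh n"
                using mesh_pos[of n] r(1) by (auto intro: mult_right_mono)
              have e: "real (s n + r) * mesh n = real (s n) * mesh n + real r * mesh n"
                by (simp add: distrib_right)
              have "T \<le> real (s n + r) * mesh n"
                unfolding e using grid_index_bounds(1)[OF T(1), of n] rm(1) by (simp add: s_def)
              moreover have "real (s n) * mesh n + real r * mesh n < (T + mesh n) + (t + mesh n)"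
                by (rule add_strict_mono)
                  (use grid_index_bounds(2)[OF T(1), of n] grid_index_bounds(2)[OF t, of n] rm(2)
                    in \<open>auto simp: s_def simp del: mult_le_cancel_right\<close>)
              then have "real (s n + r) * mesh n < D" unfolding e using elim by (simp add: field_simps)
              ultimately have "T \<le> real (s n + r) * mesh n" "real (s n + r) * mesh n < D" by auto
              then show False using D(3) r(2) by blast
            qed
          qed
          then show ?thesis by eventually_elim (use False dD in simp)
        qed
      qed
      show ?thesis using start ret by eventually_elim (use group in auto)
    qed
    ultimately show ?thesis by simp
  qed
  then show ?start ?return by blast+
qed

section \<open>Countable decompositions and limits of events\<close>

context prob_space
begin

lemma prob_limit_of_events:
  assumes meas: "\<And>n. {\<omega> \<in> space M. P n \<omega>} \<in> events"
    and lim: "\<And>\<omega>. \<omega> \<in> space M \<Longrightarrow> \<forall>\<^sub>F n in sequentially. P n \<omega> \<longleftrightarrow> P' \<omega>"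
  shows "(\<lambda>n. \<P>(\<omega> in M. P n \<omega>)) \<longlonglongrightarrow> \<P>(\<omega> in M. P' \<omega>)"
proof -
  let ?A = "\<lambda>n. {\<omega> \<in> space M. P n \<omega>}"
  have "{\<omega> \<in> space M. P' \<omega>} = (\<Union>N. \<Inter>n\<in>{N..}. ?A n)"
  proof (intro set_eqI iffI)
    fix \<omega> assume "\<omega> \<in> {\<omega> \<in> space M. P' \<omega>}"
    then show "\<omega> \<in> (\<Union>N. \<Inter>n\<in>{N..}. ?A n)"
      using lim[of \<omega>] by (auto simp: eventually_sequentially)
  next
    fix \<omega> assume "\<omega> \<in> (\<Union>N. \<Inter>n\<in>{N..}. ?A n)"
    then obtain N where N: "\<omega> \<in> space M" "\<And>n. n \<ge> N \<Longrightarrow> P n \<omega>" by fastforce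
    obtain N' where "\<And>n. n \<ge> N' \<Longrightarrow> P n \<omega> \<longleftrightarrow> P' \<omega>"
      using lim[OF N(1)] by (auto simp: eventually_sequentially)
    then have "P' \<omega>" using N(2)[of "max N N'"] by auto
    then show "\<omega> \<in> {\<omega> \<in> space M. P' \<omega>}" using N(1) by simp
  qed
  moreover have "(\<Union>N. \<Inter>n\<in>{N..}. ?A n) \<in> events"
    using meas by (intro sets.countable_UN sets.countable_INT) auto
  ultimately have meas': "{\<omega> \<in> space M. P' \<omega>} \<in> events" by simp
  have "(\<lambda>n. \<integral>\<omega>. indicator (?A n) \<omega> \<partial>M) \<longlonglongrightarrow> (\<integral>\<omega>. (indicator {\<omega> \<in> space M. P' \<omega>} \<omega> :: real) \<partial>M)"
  proof (rule integral_dominated_convergence[where w = "\<lambda>_. 1"])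
    show "AE \<omega> in M. (\<lambda>n. indicator (?A n) \<omega> :: real) \<longlonglongrightarrow> indicator {\<omega> \<in> space M. P' \<omega>} \<omega>"
    proof (rule AE_I2)
      fix \<omega> assume "\<omega> \<in> space M"
      from lim[OF this] have "\<forall>\<^sub>F n in sequentially. (indicator (?A n) \<omega> :: real) = indicator {\<omega> \<in> space M. P' \<omega>} \<omega>"
        by eventually_elim (auto simp: indicator_def)
      then show "(\<lambda>n. indicator (?A n) \<omega> :: real) \<longlonglongrightarrow> indicator {\<omega> \<in> space M. P' \<omega>} \<omega>"
        by (rule tendsto_eventually)
    qed
  qed (use meas meas' in \<open>auto simp: indicator_def\<close>)
  then show ?thesis using meas meas' by simp
qed

text \<open>
  The law of total probability over the values of a random variable with countably many values, as an
  unordered sum, which is the form in which transition functions are given.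
\<close>
lemma prob_has_sum_values:
  fixes Y :: "'a \<Rightarrow> 's::countable"
  assumes Y: "Y \<in> measurable M (count_space S)" and P: "{\<omega> \<in> space M. P \<omega>} \<in> events"
  shows "((\<lambda>y. \<P>(\<omega> in M. P \<omega> \<and> Y \<omega> = y)) has_sum \<P>(\<omega> in M. P \<omega>)) S"
proof -
  define A where "A n = {\<omega> \<in> space M. P \<omega> \<and> to_nat (Y \<omega>) = n}" for n
  have YS: "Y \<omega> \<in> S" if "\<omega> \<in> space M" for \<omega> using measurable_space[OF Y that] by simp
  have "Y -` {y. to_nat y = n} \<inter> space M \<in> events" for n
  proof -
    have "Y -` {y \<in> S. to_nat y = n} \<inter> space M \<in> events"
      by (rule measurable_sets[OF Y]) auto
    moreover have "Y -` {y \<in> S. to_nat y = n} \<inter> space M = Y -` {y. to_nat y = n} \<inter> space M"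
      using YS by auto
    ultimately show ?thesis by simp
  qed
  moreover have "A n = {\<omega> \<in> space M. P \<omega>} \<inter> (Y -` {y. to_nat y = n} \<inter> space M)" for n
    by (auto simp: A_def)
  ultimately have "A n \<in> events" for n using P by auto
  then have "(\<lambda>n. prob (A n)) sums prob (\<Union>n. A n)"
    by (intro finite_measure_UNION) (auto simp: A_def disjoint_family_on_def)
  moreover have "(\<Union>n. A n) = {\<omega> \<in> space M. P \<omega>}" by (auto simp: A_def)
  ultimately have "((\<lambda>n. prob (A n)) has_sum \<P>(\<omega> in M. P \<omega>)) UNIV"
    by (intro sums_nonneg_imp_has_sum) auto
  also have "?this \<longleftrightarrow> ((\<lambda>n. prob (A n)) has_sum \<P>(\<omega> in M. P \<omega>)) (to_nat ` S)"
  proof (rule has_sum_cong_neutral)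
    fix n assume "n \<in> UNIV - to_nat ` S"
    then have "A n = {}" using YS by (auto simp: A_def)
    then show "prob (A n) = 0" by simp
  qed auto
  also have "\<dots> \<longleftrightarrow> ((\<lambda>y. prob (A (to_nat y))) has_sum \<P>(\<omega> in M. P \<omega>)) S"
    using has_sum_reindex[of to_nat S "\<lambda>n. prob (A n)"] by (simp add: o_def inj_on_def)
  finally show ?thesis by (simp add: A_def)
qed

end

section \<open>The busy period of the queue\<close>

text \<open>
  The queue together with one transition function for which the Markov property holds.
\<close>
locale erlang_sample = phase_chain k l \<mu> lam "erlang_states k" p "erlang_rate k l \<mu> lam"
    "\<lambda>x. if x = (0, 0) then erlang_parameters.arrival_rate l lam else erlang_parameters.event_rate k l \<mu> lam"
    "erlang_parameters.event_rate k l \<mu> lam" "phases k" + prob_space M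
  for k l :: nat and \<mu> :: real and lam :: "nat \<Rightarrow> real"
    and p :: "real \<Rightarrow> nat \<times> nat \<Rightarrow> nat \<times> nat \<Rightarrow> real" and M :: "'w measure" +
  fixes Q :: "real \<Rightarrow> 'w \<Rightarrow> nat \<times> nat"
  assumes queue_measurable: "\<And>t. 0 \<le> t \<Longrightarrow> Q t \<in> measurable M (count_space (erlang_states k))"
    and markov: "\<And>(n::nat) (\<tau>::nat \<Rightarrow> real) x. 0 \<le> \<tau> 0 \<Longrightarrow> (\<forall>i\<le>n. \<tau> i < \<tau> (Suc i)) \<Longrightarrow>
      (\<forall>i\<le>Suc n. x i \<in> erlang_states k) \<Longrightarrow>
      \<P>(\<omega> in M. \<forall>i\<le>Suc n. Q (\<tau> i) \<omega> = x i) =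
      \<P>(\<omega> in M. \<forall>i\<le>n. Q (\<tau> i) \<omega> = x i) * p (\<tau> (Suc n) - \<tau> n) (x n) (x (Suc n))"
    and starts_empty: "AE \<omega> in M. Q 0 \<omega> = (0, 0)"
    and right_continuous: "\<And>\<omega> t. \<omega> \<in> space M \<Longrightarrow> 0 \<le> t \<Longrightarrow> \<forall>\<^sub>F u in at_right t. Q u \<omega> = Q t \<omega>"
begin

lemma queue_state: "0 \<le> t \<Longrightarrow> \<omega> \<in> space M \<Longrightarrow> Q t \<omega> \<in> erlang_states k"
  using measurable_space[OF queue_measurable] by simp

lemma empty_iff: "0 \<le> t \<Longrightarrow> \<omega> \<in> space M \<Longrightarrow> fst (Q t \<omega>) = 0 \<longleftrightarrow> Q t \<omega> = (0, 0)"
  using queue_state[of t \<omega>] by (auto simp: erlang_states_def)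

lemma pred_queue:
  assumes "0 \<le> t" shows "Measurable.pred M (\<lambda>\<omega>. P (Q t \<omega>))"
  by (rule measurable_compose[OF queue_measurable[OF assms]]) simp

definition on_path :: "real \<Rightarrow> nat \<Rightarrow> (nat \<Rightarrow> nat \<times> nat) \<Rightarrow> 'w \<Rightarrow> bool" where
  "on_path h j x \<omega> \<longleftrightarrow> (\<forall>i\<le>j. Q (real i * h) \<omega> = x i)"

lemma pred_on_path: "0 \<le> h \<Longrightarrow> Measurable.pred M (on_path h j x)"
  unfolding on_path_def[abs_def] atMost_iff[symmetric] Ball_def[symmetric]
  by (intro pred_intros_finite pred_queue[where P = "\<lambda>y. y = _"]) auto

lemma on_path_cong: "(\<And>i. i \<le> j \<Longrightarrow> x i = y i) \<Longrightarrow> on_path h j x = on_path h j y"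
  by (auto simp: on_path_def fun_eq_iff)

lemma on_path_Suc: "on_path h (Suc j) x \<omega> \<longleftrightarrow> on_path h j x \<omega> \<and> Q (real (Suc j) * h) \<omega> = x (Suc j)"
  by (auto simp: on_path_def le_Suc_eq)

lemma prob_on_path_Suc:
  assumes "0 < h" "\<And>i. i \<le> Suc j \<Longrightarrow> x i \<in> erlang_states k"
  shows "\<P>(\<omega> in M. on_path h (Suc j) x \<omega>) = \<P>(\<omega> in M. on_path h j x \<omega>) * p h (x j) (x (Suc j))"
  using markov[of "\<lambda>i. real i * h" j x] assms by (simp add: on_path_def distrib_right)

lemma pred_grid_return: "0 \<le> h \<Longrightarrow> Measurable.pred M (grid_return Q h J i)"
  unfolding grid_return_def[abs_def] atMost_iff[symmetric] Bex_def[symmetric]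
  by (intro pred_intros_finite pred_queue[where P = "\<lambda>y. fst y = 0"]) auto

lemma pred_grid_start: "0 \<le> h \<Longrightarrow> Measurable.pred M (grid_start Q h m i)"
  unfolding grid_start_def[abs_def] lessThan_iff[symmetric] Ball_def[symmetric]
  by (intro pred_intros_logic pred_intros_finite
      pred_queue[where P = "\<lambda>y. fst y = 0"] pred_queue[where P = "\<lambda>y. fst y = m"]) auto

text \<open>
  The Markov property for the event that the system is seen empty within \<open>J\<close> grid steps after the time
  of the last prescribed state. The induction on \<open>J\<close> prolongs the prescribed path by one state and
  sums over its value.
\<close>
lemma prob_path_return:
  assumes h: "0 < h" and x: "\<And>i. i \<le> j \<Longrightarrow> x i \<in> erlang_states k"
  shows "\<P>(\<omega> in M. on_path h j x \<omega> \<and> grid_return Q h J j \<omega>) =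
    \<P>(\<omega> in M. on_path h j x \<omega>) * grid_hit h J (x j)"
  using x
proof (induction J arbitrary: j x)
  case 0
  have "on_path h j x \<omega> \<and> grid_return Q h 0 j \<omega> \<longleftrightarrow> on_path h j x \<omega> \<and> x j = (0, 0)"
    if "\<omega> \<in> space M" for \<omega>
    using that 0[of j] by (auto simp: on_path_def grid_return_def erlang_states_def)
  then have "{\<omega> \<in> space M. on_path h j x \<omega> \<and> grid_return Q h 0 j \<omega>}
      = (if x j = (0, 0) then {\<omega> \<in> space M. on_path h j x \<omega>} else {})" by auto
  then show ?case using phases_eq_0_iff[OF 0[of j]] by simp
next
  case (Suc J)
  have xj: "x j \<in> erlang_states k" using Suc.prems by simp
  show ?case
  proof (cases "x j = (0, 0)")
    case True
    then have "on_path h j x \<omega> \<Longrightarrow> grid_return Q h (Suc J) j \<omega>" for \<omega>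
      by (auto simp: on_path_def grid_return_def intro!: exI[of _ 0])
    then have "on_path h j x \<omega> \<and> grid_return Q h (Suc J) j \<omega> \<longleftrightarrow> on_path h j x \<omega>" for \<omega>
      by blast
    then show ?thesis using True phases_eq_0_iff[OF xj] by simp
  next
    case False
    define x' where "x' y = x(Suc j := y)" for y
    have shift: "grid_return Q h (Suc J) j \<omega> \<longleftrightarrow> grid_return Q h J (Suc j) \<omega>"
      if "on_path h j x \<omega>" for \<omega>
    proof -
      have "fst (Q (real j * h) \<omega>) \<noteq> 0"
        using that xj False by (auto simp: on_path_def erlang_states_def)
      moreover have "(\<exists>r\<le>Suc J. P r) \<longleftrightarrow> P 0 \<or> (\<exists>r\<le>J. P (Suc r))" for P :: "nat \<Rightarrow> bool"
        by (metis Suc_le_mono bot_nat_0.extremum not0_implies_Suc)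
      ultimately show ?thesis
        unfolding grid_return_def by (simp del: of_nat_add of_nat_Suc)
    qed
    have "((\<lambda>y. \<P>(\<omega> in M. (on_path h j x \<omega> \<and> grid_return Q h (Suc J) j \<omega>) \<and> Q (real (Suc j) * h) \<omega> = y))
        has_sum \<P>(\<omega> in M. on_path h j x \<omega> \<and> grid_return Q h (Suc J) j \<omega>)) (erlang_states k)"
      using h by (intro prob_has_sum_values queue_measurable predE pred_intros_logic pred_on_path pred_grid_return) auto
    moreover have "\<P>(\<omega> in M. (on_path h j x \<omega> \<and> grid_return Q h (Suc J) j \<omega>) \<and> Q (real (Suc j) * h) \<omega> = y)
        = \<P>(\<omega> in M. on_path h j x \<omega>) * (p h (x j) y * grid_hit h J y)" if y: "y \<in> erlang_states k" for y
    proof -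
      have path: "on_path h j (x' y) = on_path h j x" by (rule on_path_cong) (simp add: x'_def)
      have "(on_path h j x \<omega> \<and> grid_return Q h (Suc J) j \<omega>) \<and> Q (real (Suc j) * h) \<omega> = y
          \<longleftrightarrow> on_path h (Suc j) (x' y) \<omega> \<and> grid_return Q h J (Suc j) \<omega>" for \<omega>
        unfolding on_path_Suc path using shift[of \<omega>] by (auto simp: x'_def)
      then have "\<P>(\<omega> in M. (on_path h j x \<omega> \<and> grid_return Q h (Suc J) j \<omega>) \<and> Q (real (Suc j) * h) \<omega> = y)
          = \<P>(\<omega> in M. on_path h (Suc j) (x' y) \<omega> \<and> grid_return Q h J (Suc j) \<omega>)" by simp
      also have "\<dots> = \<P>(\<omega> in M. on_path h (Suc j) (x' y) \<omega>) * grid_hit h J (x' y (Suc j))"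
        by (rule Suc.IH) (use Suc.prems y in \<open>auto simp: x'_def\<close>)
      also have "\<P>(\<omega> in M. on_path h (Suc j) (x' y) \<omega>) = \<P>(\<omega> in M. on_path h j x \<omega>) * p h (x j) y"
        using prob_on_path_Suc[OF h, of j "x' y"] Suc.prems y unfolding path by (auto simp: x'_def)
      finally show ?thesis by (simp add: x'_def)
    qed
    ultimately have "((\<lambda>y. \<P>(\<omega> in M. on_path h j x \<omega>) * (p h (x j) y * grid_hit h J y))
        has_sum \<P>(\<omega> in M. on_path h j x \<omega> \<and> grid_return Q h (Suc J) j \<omega>)) (erlang_states k)"
      by (subst (asm) has_sum_cong) auto
    moreover have "((\<lambda>y. \<P>(\<omega> in M. on_path h j x \<omega>) * (p h (x j) y * grid_hit h J y))
        has_sum \<P>(\<omega> in M. on_path h j x \<omega>) * grid_hit h (Suc J) (x j)) (erlang_states k)"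
      using h phases_eq_0_iff[OF xj] False by (intro has_sum_cmult_right grid_hit_has_sum xj) auto
    ultimately show ?thesis by (rule has_sum_unique)
  qed
qed

lemma idle_state: "(0, 0) \<in> erlang_states k"
  by (simp add: erlang_states_def)

lemma prob_idle_path:
  assumes "0 < h"
  shows "\<P>(\<omega> in M. on_path h j (\<lambda>_. (0, 0)) \<omega>) = p h (0, 0) (0, 0) ^ j"
proof (induction j)
  case 0
  have "AE \<omega> in M. on_path h 0 (\<lambda>_. (0, 0)) \<omega>" using starts_empty by (simp add: on_path_def)
  then have "\<P>(\<omega> in M. on_path h 0 (\<lambda>_. (0, 0)) \<omega>) = 1"
    using assms pred_on_path[of h 0 "\<lambda>_. (0, 0)"] by (subst prob_Collect_eq_1) (auto simp: pred_def)
  then show ?case by simp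
next
  case (Suc j)
  then show ?case using prob_on_path_Suc[OF assms, of j "\<lambda>_. (0, 0)"] by (simp add: idle_state)
qed

text \<open>
  The probability that the queue is first seen busy at step \<open>i + 1\<close> of the grid, in state \<open>(m, s)\<close>, is
  \<open>p h (0, 0) (0, 0) ^ i * p h (0, 0) (m, s)\<close>; the sum over \<open>i\<close> is geometric. The event \<open>D i\<close> about
  the behaviour after step \<open>i\<close> enters only through the Markov property \<open>W\<close>, so that the law of
  the first group alone and its joint law with the end of the busy period are both special cases.
\<close>
lemma prob_first_group:
  assumes h: "0 < h" and m: "m \<noteq> 0" and lt: "p h (0, 0) (0, 0) < 1"
    and D: "\<And>i. Measurable.pred M (D i)"
    and W: "\<And>j x. (\<And>i. i \<le> j \<Longrightarrow> x i \<in> erlang_states k) \<Longrightarrow>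
      \<P>(\<omega> in M. on_path h j x \<omega> \<and> D j \<omega>) = \<P>(\<omega> in M. on_path h j x \<omega>) * W (x j)"
  shows "\<P>(\<omega> in M. \<exists>i. grid_start Q h m i \<omega> \<and> D i \<omega>) =
    (\<Sum>s=1..k. p h (0, 0) (m, s) / (1 - p h (0, 0) (0, 0)) * W (m, s))"
proof -
  let ?p0 = "p h (0, 0) (0, 0)"
  define x where "x i s = (\<lambda>j. if j = Suc i then (m, s) else (0, 0))" for i s :: nat
  define E where "E i s = {\<omega> \<in> space M. on_path h (Suc i) (x i s) \<omega> \<and> D (Suc i) \<omega>}" for i s
  define B where "B i = (\<Union>s\<in>{1..k}. E i s)" for i
  have state: "(m, s) \<in> erlang_states k" if "s \<in> {1..k}" for s
    using m that by (simp add: erlang_states_def)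
  have E_meas: "E i s \<in> events" for i s
    unfolding E_def using h by (intro predE pred_intros_logic pred_on_path D) auto
  have path: "on_path h (Suc i) (x i s) \<omega> \<longleftrightarrow>
      on_path h i (\<lambda>_. (0, 0)) \<omega> \<and> Q (real (Suc i) * h) \<omega> = (m, s)" for i s \<omega>
  proof -
    have "on_path h i (x i s) = on_path h i (\<lambda>_. (0, 0))" by (rule on_path_cong) (simp add: x_def)
    then show ?thesis by (simp add: on_path_Suc x_def)
  qed
  have E_prob: "prob (E i s) = ?p0 ^ i * (p h (0, 0) (m, s) * W (m, s))" if s: "s \<in> {1..k}" for i s
  proof -
    have xs: "x i s j \<in> erlang_states k" for j using state[OF s] idle_state by (simp add: x_def)
    have "on_path h i (x i s) = on_path h i (\<lambda>_. (0, 0))" by (rule on_path_cong) (simp add: x_def)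
    then have "\<P>(\<omega> in M. on_path h (Suc i) (x i s) \<omega>) = ?p0 ^ i * p h (0, 0) (m, s)"
      using prob_on_path_Suc[OF h xs, of i] prob_idle_path[OF h, of i] by (simp add: x_def)
    then show ?thesis
      unfolding E_def W[OF xs] by (simp add: x_def)
  qed
  have B_prob: "prob (B i) = ?p0 ^ i * (\<Sum>s=1..k. p h (0, 0) (m, s) * W (m, s))" for i
  proof -
    have "prob (B i) = (\<Sum>s=1..k. prob (E i s))"
      unfolding B_def
      by (rule finite_measure_finite_Union) (use E_meas path in \<open>auto simp: E_def disjoint_family_on_def\<close>)
    then show ?thesis using E_prob by (simp add: sum_distrib_left)
  qed
  have B_meas: "B i \<in> events" for i using E_meas by (auto simp: B_def)
  have B_iff: "\<omega> \<in> B i \<longleftrightarrow> grid_start Q h m (Suc i) \<omega> \<and> D (Suc i) \<omega>" if "\<omega> \<in> space M" for i \<omega>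
  proof -
    have "Q (real (Suc i) * h) \<omega> \<in> erlang_states k" using h that by (intro queue_state) auto
    then have "fst (Q (real (Suc i) * h) \<omega>) = m \<longleftrightarrow> (\<exists>s\<in>{1..k}. Q (real (Suc i) * h) \<omega> = (m, s))"
      using m by (cases "Q (real (Suc i) * h) \<omega>") (auto simp: erlang_states_def)
    moreover have "on_path h i (\<lambda>_. (0, 0)) \<omega> \<longleftrightarrow> (\<forall>j<Suc i. fst (Q (real j * h) \<omega>) = 0)"
      using empty_iff[OF _ that] h by (auto simp: on_path_def less_Suc_eq_le)
    ultimately have "grid_start Q h m (Suc i) \<omega> \<longleftrightarrow>
        (\<exists>s\<in>{1..k}. on_path h i (\<lambda>_. (0, 0)) \<omega> \<and> Q (real (Suc i) * h) \<omega> = (m, s))"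
      unfolding grid_start_def by (simp only: bex_simps) blast
    then show ?thesis using that by (simp only: B_def E_def path UN_iff mem_Collect_eq simp_thms) blast
  qed
  have "disjoint_family B"
  proof -
    have "i = j" if "\<omega> \<in> B i" "\<omega> \<in> B j" for i j \<omega>
    proof -
      have "\<omega> \<in> space M" using that(1) by (auto simp: B_def E_def)
      then have "grid_start Q h m (Suc i) \<omega>" "grid_start Q h m (Suc j) \<omega>" using that B_iff by auto
      then have "Suc i = Suc j" by (rule grid_start_unique[OF m m])
      then show ?thesis by simp
    qed
    then show ?thesis by (auto simp: disjoint_family_on_def)
  qed
  then have "(\<lambda>i. prob (B i)) sums prob (\<Union>i. B i)"
    using B_meas by (intro finite_measure_UNION) auto
  moreover have "(\<lambda>i. prob (B i)) sums (1 / (1 - ?p0) * (\<Sum>s=1..k. p h (0, 0) (m, s) * W (m, s)))"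
    unfolding B_prob using lt p_nonneg[of h "(0, 0)" "(0, 0)"] h idle_state
    by (intro sums_mult2 geometric_sums) auto
  ultimately have "prob (\<Union>i. B i) = 1 / (1 - ?p0) * (\<Sum>s=1..k. p h (0, 0) (m, s) * W (m, s))"
    by (rule sums_unique2)
  moreover have "prob (\<Union>i. B i) = \<P>(\<omega> in M. \<exists>i. grid_start Q h m i \<omega> \<and> D i \<omega>)"
  proof (rule finite_measure_eq_AE)
    \<comment> \<open>The events \<open>B i\<close> leave out a start at step 0, which has probability zero.\<close>
    show "AE \<omega> in M. \<omega> \<in> (\<Union>i. B i) \<longleftrightarrow> \<omega> \<in> {\<omega> \<in> space M. \<exists>i. grid_start Q h m i \<omega> \<and> D i \<omega>}"
      using starts_empty AE_space
    proof eventually_elim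
      case (elim \<omega>)
      have "\<not> grid_start Q h m 0 \<omega>" using elim m by (simp add: grid_start_def)
      then have "(\<exists>i. grid_start Q h m i \<omega> \<and> D i \<omega>) \<longleftrightarrow> (\<exists>i. grid_start Q h m (Suc i) \<omega> \<and> D (Suc i) \<omega>)"
        by (metis (no_types) not0_implies_Suc)
      then show ?case using elim(2) by (simp only: UN_iff B_iff[OF elim(2)] mem_Collect_eq bex_UNIV simp_thms)
    qed
    show "(\<Union>i. B i) \<in> events" using B_meas by auto
    show "{\<omega> \<in> space M. \<exists>i. grid_start Q h m i \<omega> \<and> D i \<omega>} \<in> events"
      using h by (intro predE pred_intros_countable pred_intros_logic pred_grid_start D) auto
  qed
  ultimately show ?thesis by (simp add: sum_divide_distrib)
qed

lemma mesh_at_right: "filterlim mesh (at_right 0) sequentially"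
  by (rule tendsto_imp_filterlim_at_right[OF mesh_tendsto]) (simp add: mesh_pos)

lemma exit_prob_limit: "(\<lambda>n. (1 - p (mesh n) (0, 0) (0, 0)) / mesh n) \<longlonglongrightarrow> arrival_rate"
  using filterlim_compose[OF exit_rate_limit[OF idle_state] mesh_at_right] by simp

lemma eventually_exit: "\<forall>\<^sub>F n in sequentially. p (mesh n) (0, 0) (0, 0) < 1"
  using order_tendstoD(1)[OF exit_prob_limit arrival_rate_pos]
proof eventually_elim
  case (elim n)
  then show ?case using mesh_pos[of n] by (simp add: zero_less_divide_iff)
qed

text \<open>
  Given that the queue has left the empty state during a step, the law of its new state becomes
  proportional to the rates as the step shrinks. In particular the phase is \<open>k\<close> in the limit, although on a grid
  the first phase seen may be a later one.
\<close>
lemma first_group_limit: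
  assumes m: "m \<in> {1..l}" and W: "\<And>s. s \<in> {1..k} \<Longrightarrow> (\<lambda>n. W n (m, s)) \<longlonglongrightarrow> w s"
  shows "(\<lambda>n. \<Sum>s=1..k. p (mesh n) (0, 0) (m, s) / (1 - p (mesh n) (0, 0) (0, 0)) * W n (m, s))
    \<longlonglongrightarrow> lam m / arrival_rate * w k"
proof -
  have rate: "erlang_rate k l \<mu> lam (0, 0) (m, s) = (if s = k then lam m else 0)" for s
    using m by (simp add: erlang_rate_idle)
  have "(\<lambda>n. p (mesh n) (0, 0) (m, s) / (1 - p (mesh n) (0, 0) (0, 0)))
      \<longlonglongrightarrow> erlang_rate k l \<mu> lam (0, 0) (m, s) / arrival_rate" if s: "s \<in> {1..k}" for s
  proof -
    have "(m, s) \<in> erlang_states k" "(0, 0) \<noteq> (m, s)" using m s by (auto simp: erlang_states_def)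
    then have "(\<lambda>n. p (mesh n) (0, 0) (m, s) / mesh n) \<longlonglongrightarrow> erlang_rate k l \<mu> lam (0, 0) (m, s)"
      by (intro filterlim_compose[OF jump_rate_limit[OF idle_state] mesh_at_right])
    from tendsto_divide[OF this exit_prob_limit] arrival_rate_pos mesh_pos
    show ?thesis by (simp add: less_imp_neq[symmetric])
  qed
  then have "(\<lambda>n. \<Sum>s=1..k. p (mesh n) (0, 0) (m, s) / (1 - p (mesh n) (0, 0) (0, 0)) * W n (m, s))
    \<longlonglongrightarrow> (\<Sum>s=1..k. erlang_rate k l \<mu> lam (0, 0) (m, s) / arrival_rate * w s)"
    by (intro tendsto_sum tendsto_mult W) auto
  also have "(\<Sum>s=1..k. erlang_rate k l \<mu> lam (0, 0) (m, s) / arrival_rate * w s)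
      = (\<Sum>s=1..k. if s = k then lam m / arrival_rate * w s else 0)"
    by (intro sum.cong) (auto simp: rate)
  also have "\<dots> = lam m / arrival_rate * w k" using k_pos by simp
  finally show ?thesis .
qed

lemma prob_initial_group:
  assumes m: "m \<in> {1..l}"
  shows "\<P>(\<omega> in M. initial_group Q \<omega> = m) = lam m / arrival_rate"
proof (rule LIMSEQ_unique)
  have m0: "m \<noteq> 0" using m by simp
  show "(\<lambda>n. \<P>(\<omega> in M. \<exists>i. grid_start Q (mesh n) m i \<omega>)) \<longlonglongrightarrow> \<P>(\<omega> in M. initial_group Q \<omega> = m)"
  proof (rule prob_limit_of_events)
    show "{\<omega> \<in> space M. \<exists>i. grid_start Q (mesh n) m i \<omega>} \<in> events" for n
      using mesh_pos[of n] by (intro predE pred_intros_countable pred_grid_start) auto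
  qed (rule busy_period_on_grid(1)[OF right_continuous m0 order_refl])
  have "\<forall>\<^sub>F n in sequentially. (\<Sum>s=1..k. p (mesh n) (0, 0) (m, s) / (1 - p (mesh n) (0, 0) (0, 0)) * 1)
      = \<P>(\<omega> in M. \<exists>i. grid_start Q (mesh n) m i \<omega>)"
    using eventually_exit
  proof eventually_elim
    case (elim n)
    show ?case using prob_first_group[OF mesh_pos m0 elim, of "\<lambda>_ _. True" "\<lambda>_. 1"] by simp
  qed
  moreover have "(\<lambda>n. \<Sum>s=1..k. p (mesh n) (0, 0) (m, s) / (1 - p (mesh n) (0, 0) (0, 0)) * 1)
      \<longlonglongrightarrow> lam m / arrival_rate * 1"
    using first_group_limit[OF m, of "\<lambda>_ _. 1" "\<lambda>_. 1"] by simp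
  ultimately show "(\<lambda>n. \<P>(\<omega> in M. \<exists>i. grid_start Q (mesh n) m i \<omega>)) \<longlonglongrightarrow> lam m / arrival_rate"
    by (simp add: tendsto_cong)
qed

lemma prob_busy_period:
  assumes m: "m \<in> {1..l}" and t: "0 \<le> t"
  shows "\<P>(\<omega> in M. initial_group Q \<omega> = m \<and> busy_duration Q \<omega> \<le> ereal t) =
    lam m / arrival_rate * hit_prob (m * k) t"
proof (rule LIMSEQ_unique)
  let ?G = "\<lambda>n \<omega>. \<exists>i. grid_start Q (mesh n) m i \<omega> \<and> grid_return Q (mesh n) (grid_index n t) i \<omega>"
  have m0: "m \<noteq> 0" using m by simp
  show "(\<lambda>n. \<P>(\<omega> in M. ?G n \<omega>)) \<longlonglongrightarrow> \<P>(\<omega> in M. initial_group Q \<omega> = m \<and> busy_duration Q \<omega> \<le> ereal t)"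
  proof (rule prob_limit_of_events)
    show "{\<omega> \<in> space M. ?G n \<omega>} \<in> events" for n
      using mesh_pos[of n]
      by (intro predE pred_intros_countable pred_intros_logic pred_grid_start pred_grid_return) auto
  qed (rule busy_period_on_grid(2)[OF right_continuous m0 t])
  have "\<forall>\<^sub>F n in sequentially. (\<Sum>s=1..k. p (mesh n) (0, 0) (m, s) / (1 - p (mesh n) (0, 0) (0, 0))
        * grid_hit (mesh n) (grid_index n t) (m, s)) = \<P>(\<omega> in M. ?G n \<omega>)"
    using eventually_exit
  proof eventually_elim
    case (elim n)
    show ?case
      using mesh_pos[of n]
      by (intro prob_first_group[OF mesh_pos m0 elim, symmetric] pred_grid_return prob_path_return) auto
  qed
  moreover have "(\<lambda>n. \<Sum>s=1..k. p (mesh n) (0, 0) (m, s) / (1 - p (mesh n) (0, 0) (0, 0))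
        * grid_hit (mesh n) (grid_index n t) (m, s)) \<longlonglongrightarrow> lam m / arrival_rate * hit_prob (phases k (m, k)) t"
  proof (rule first_group_limit[OF m, of "\<lambda>n. grid_hit (mesh n) (grid_index n t)" "\<lambda>s. hit_prob (phases k (m, s)) t"])
    fix s assume "s \<in> {1..k}"
    then have "(m, s) \<in> erlang_states k" using m by (auto simp: erlang_states_def)
    then show "(\<lambda>n. grid_hit (mesh n) (grid_index n t) (m, s)) \<longlonglongrightarrow> hit_prob (phases k (m, s)) t"
      using mesh_pos by (intro grid_hit_limit mesh_tendsto grid_index_tendsto t) (auto simp: less_imp_le)
  qed
  moreover have "phases k (m, k) = m * k"
    using m by (cases m) (auto simp: phases_def algebra_simps)
  ultimately show "(\<lambda>n. \<P>(\<omega> in M. ?G n \<omega>)) \<longlonglongrightarrow> lam m / arrival_rate * hit_prob (m * k) t"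
    by (simp add: tendsto_cong)
qed

text \<open>
  The conditioning event has the positive probability \<open>lam m / arrival_rate\<close>, which cancels.
\<close>
lemma busy_period_distribution:
  assumes m: "m \<in> {1..l}" and t: "0 \<le> t"
  shows "\<P>(\<omega> in M. busy_duration Q \<omega> \<le> ereal t \<bar> initial_group Q \<omega> * k = m * k) = hit_prob (m * k) t"
proof -
  have "initial_group Q \<omega> * k = m * k \<longleftrightarrow> initial_group Q \<omega> = m" for \<omega> using k_pos by simp
  moreover have "lam m / arrival_rate \<noteq> 0" using lam_pos[OF m] arrival_rate_pos by simp
  ultimately show ?thesis
    using prob_initial_group[OF m] prob_busy_period[OF m t]
    by (simp add: cond_prob_def conj_commute)
qed

end

context erlang_parameters
begin

lemma erlang_queue_busy_period:
  assumes Q: "erlang_queue M Q k l \<mu> lam" and m: "m \<in> {1..l}" and t: "0 \<le> t"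
  shows "\<P>(\<omega> in M. busy_duration Q \<omega> \<le> ereal t \<bar> initial_group Q \<omega> * k = m * k) = hit_prob (m * k) t"
proof -
  have mp: "markov_process M Q (erlang_states k) (erlang_rate k l \<mu> lam)"
    and rc: "right_continuous_paths M Q" and Q0: "AE \<omega> in M. Q 0 \<omega> = (0, 0)"
    using Q by (auto simp: erlang_queue_def)
  interpret prob_space M using mp by (simp add: markov_process_def)
  obtain p where p: "transition_function (erlang_states k) p"
      "has_transition_rates (erlang_states k) p (erlang_rate k l \<mu> lam)"
    and fdd: "\<forall>(n::nat) (\<tau>::nat \<Rightarrow> real) x. 0 \<le> \<tau> 0 \<longrightarrow> (\<forall>i\<le>n. \<tau> i < \<tau> (Suc i)) \<longrightarrow>
       (\<forall>i\<le>Suc n. x i \<in> erlang_states k) \<longrightarrow>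
       \<P>(\<omega> in M. \<forall>i\<le>Suc n. Q (\<tau> i) \<omega> = x i) =
       \<P>(\<omega> in M. \<forall>i\<le>n. Q (\<tau> i) \<omega> = x i) * p (\<tau> (Suc n) - \<tau> n) (x n) (x (Suc n))"
    using mp unfolding markov_process_def by blast
  interpret phase_chain k l \<mu> lam "erlang_states k" p "erlang_rate k l \<mu> lam"
    "\<lambda>x. if x = (0, 0) then arrival_rate else event_rate" event_rate "phases k"
    by (rule erlang_phase_chain[OF p])
  interpret erlang_sample k l \<mu> lam p M Q
  proof unfold_locales
    show "Q t \<in> measurable M (count_space (erlang_states k))" if "0 \<le> t" for t
      using mp that by (simp add: markov_process_def)
    show "\<forall>\<^sub>F u in at_right t. Q u \<omega> = Q t \<omega>" if "\<omega> \<in> space M" "0 \<le> t" for \<omega> t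
      using rc that by (simp add: right_continuous_paths_def)
  qed (use fdd Q0 in auto)
  show ?thesis by (rule busy_period_distribution[OF m t])
qed

end

theorem theorem2p3:
  fixes k l a :: nat and \<mu> \<Lambda> t :: real and lam c :: "nat \<Rightarrow> real"
    and M :: "'w measure" and Q :: "real \<Rightarrow> 'w \<Rightarrow> nat \<times> nat"
    and M' :: "'v measure" and L :: "real \<Rightarrow> 'v \<Rightarrow> nat"
  assumes "k \<ge> 1" and "l \<ge> 1" and "\<mu> > 0"
    and "\<And>m. m \<in> {1..l} \<Longrightarrow> lam m > 0"
    and "\<Lambda> = (\<Sum>m=1..l. lam m)"
    and "\<And>m. m \<in> {1..l} \<Longrightarrow> c m = lam m / \<Lambda>"
    and "a \<in> (\<lambda>m. m * k) ` {1..l}"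
    and "erlang_queue M Q k l \<mu> lam"
    and "absorbed_phase_process M' L k l \<mu> lam a"
    and "t \<ge> 0"
  shows "summable (busy_series_term k l \<mu> \<Lambda> c a t) \<and>
    \<P>(\<omega> in M. busy_duration Q \<omega> \<le> ereal t \<bar> initial_group Q \<omega> * k = a) =
      real a * (\<Sum>n. busy_series_term k l \<mu> \<Lambda> c a t n) \<and>
    \<P>(\<omega> in M'. L t \<omega> = 0 \<bar> L 0 \<omega> = a) =
      real a * (\<Sum>n. busy_series_term k l \<mu> \<Lambda> c a t n)"
proof -
  interpret erlang_parameters k l \<mu> lam by unfold_locales (use assms in auto)
  have \<Lambda>: "\<Lambda> = arrival_rate" using assms(5) by (simp add: arrival_rate_def)
  obtain m where m: "m \<in> {1..l}" "a = m * k" using assms(7) by auto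
  have a: "a \<noteq> 0" using m k_pos by simp
  have "(\<lambda>n. real a * busy_series_term k l \<mu> \<Lambda> c a t n) sums hit_prob a t"
    unfolding \<Lambda> by (rule busy_series_sums) (use assms(6,10) a \<Lambda> in auto)
  from sums_mult[OF this, of "1 / real a"] a
  have s: "busy_series_term k l \<mu> \<Lambda> c a t sums (hit_prob a t / real a)" by simp
  then have "real a * (\<Sum>n. busy_series_term k l \<mu> \<Lambda> c a t n) = hit_prob a t"
    using a by (simp add: sums_iff)
  moreover have "\<P>(\<omega> in M. busy_duration Q \<omega> \<le> ereal t \<bar> initial_group Q \<omega> * k = a) = hit_prob a t"
    unfolding m(2) by (rule erlang_queue_busy_period[OF assms(8) m(1) assms(10)])
  moreover have "\<P>(\<omega> in M'. L t \<omega> = 0 \<bar> L 0 \<omega> = a) = hit_prob a t"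
    by (rule absorbed_process_prob[OF assms(9) a assms(10)])
  ultimately show ?thesis using s sums_summable by auto
qed

end
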